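(* Consider a locally Lipschitz function $f\colon\mathbf{R}^n\to\mathbf{R}$, a mollifier $\phi\colon\mathbf{R}^n\to\mathbf{R}$, and a direction $w\in\mathbf{R}^n$. Then for almost all points $z\in\mathbf{R}^n$, the function $f$ is differentiable almost everywhere on the line $z+\mathbf{R}w$, and the distributional second derivative $D^2h$ of the function defined by \[ h(t)=f(z+tw)\qquad(t\in\mathbf{R}) \] is the distributional limit, as $\gamma\downarrow0$, of the function \[ t\ \mapsto\ \Big(\phi_\gamma\star\big(w^T(D^2f)w\big)\Big)(z+tw). \]
   Context: Test functions are smooth compactly supported real-valued functions. For locally Lipschitz $f\colon\mathbf{R}^n\to\mathbf{R}$, the gradient $\nabla f$ exists almost everywhere and is locally essentially bounded, and the second distributional derivative $D^2f$ is the $n\times n$ matrix of distributions defined by \[ \langle u^T(D^2f)v,\,g\rangle=-\int(u^T\nabla f)(v^T\nabla g) \] for all vectors $u,v\in\mathbf{R}^n$ and test functions $g$. In particular for locally Lipschitz $h\colon\mathbf{R}\to\mathbf{R}$, $\langle D^2h,g\rangle=-\int h'g'$ for test functions $g$ on $\mathbf{R}$. A mollifier is a test function $\phi\colon\mathbf{R}^n\to\mathbf{R}$ with $\int\phi=1$ and such that $\phi_\gamma(x)=\gamma^{-n}\phi(\frac1\gamma x)$ converges as a distribution to the Dirac delta function as $\gamma\downarrow0$. The convolution of a test function $g$ with a Radon measure $\mu$ on $\mathbf{R}^n$ is $(g\star\mu)(y)=\int g(y-x)\,d\mu(x)$; for a distribution $T$ on $\mathbf{R}^n$ the same formula is read as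 $(g\star T)(y)=\langle T,\,g(y-\cdot)\rangle$. "Distributional limit" means: for every test function $g\colon\mathbf{R}\to\mathbf{R}$, the integrals of $g$ against the functions of $t$ converge to $\langle D^2h,g\rangle$ as $\gamma\downarrow0$. *)

theory Defs
  imports "HOL-Analysis.Analysis"
begin

definition locally_lipschitz :: "('a::metric_space \<Rightarrow> 'b::metric_space) \<Rightarrow> bool" where
  "locally_lipschitz f \<longleftrightarrow> (\<forall>x. \<exists>u>0. \<exists>L. L-lipschitz_on (cball x u) f)"

text \<open>In finite dimension, continuity of \<open>x \<mapsto> Df(x) v\<close> for every \<open>v\<close> is the same as
  continuity of \<open>Df\<close>, so \<open>C_k k\<close> is the usual class of \<open>k\<close> times continuously
  differentiable functions.\<close>

primrec C_k :: "nat \<Rightarrow> ('a::euclidean_space \<Rightarrow> real) \<Rightarrow> bool" where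
  "C_k 0 f \<longleftrightarrow> continuous_on UNIV f"
| "C_k (Suc k) f \<longleftrightarrow> (\<forall>x. f differentiable (at x)) \<and>
     (\<forall>v. C_k k (\<lambda>x. frechet_derivative f (at x) v))"

definition smooth :: "('a::euclidean_space \<Rightarrow> real) \<Rightarrow> bool" where
  "smooth f \<longleftrightarrow> (\<forall>k. C_k k f)"

definition test_function :: "('a::euclidean_space \<Rightarrow> real) \<Rightarrow> bool" where
  "test_function g \<longleftrightarrow> smooth g \<and> compact (closure {x. g x \<noteq> 0})"

text \<open>A distribution is represented by its values on test functions; its values on other
  functions are irrelevant.\<close>

type_synonym 'a distribution = "('a \<Rightarrow> real) \<Rightarrow> real"

text \<open>The value 0 at points of non-differentiability is a dummy: for locally Lipschitz
  functions these points form a null set.\<close>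

definition grad :: "('a::euclidean_space \<Rightarrow> real) \<Rightarrow> 'a \<Rightarrow> 'a" where
  "grad f x = (if f differentiable (at x) then (THE D. GDERIV f x :> D) else 0)"

text \<open>\<open>D2 f u v\<close> is the distribution \<open>u\<^sup>T (D\<^sup>2 f) v\<close>. The entries of the matrix \<open>D\<^sup>2 f\<close>
  are obtained by letting \<open>u\<close> and \<open>v\<close> range over the standard basis.\<close>

definition D2 :: "('a::euclidean_space \<Rightarrow> real) \<Rightarrow> 'a \<Rightarrow> 'a \<Rightarrow> 'a distribution" where
  "D2 f u v = (\<lambda>g. - (\<integral>x. (u \<bullet> grad f x) * (v \<bullet> grad g x) \<partial>lebesgue))"

text \<open>On the real line \<open>D\<^sup>2 h\<close> is a 1 by 1 matrix of distributions; this is its entry,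
  \<open>g \<mapsto> - \<integral> h' g'\<close>.\<close>

abbreviation D2_real :: "(real \<Rightarrow> real) \<Rightarrow> real distribution" where
  "D2_real h \<equiv> D2 h 1 1"

text \<open>Integrability is required explicitly because the Bochner integral of a non-integrable
  function is 0 by convention.\<close>

definition distributional_limit ::
    "(real \<Rightarrow> 'a::euclidean_space \<Rightarrow> real) \<Rightarrow> 'a distribution \<Rightarrow> bool" where
  "distributional_limit F T \<longleftrightarrow> (\<forall>g. test_function g \<longrightarrow>
     (\<forall>\<gamma>>0. integrable lebesgue (\<lambda>x. g x * F \<gamma> x)) \<and>
     ((\<lambda>\<gamma>. \<integral>x. g x * F \<gamma> x \<partial>lebesgue) \<longlongrightarrow> T g) (at_right 0))"

definition rescale :: "real \<Rightarrow> ('a::euclidean_space \<Rightarrow> real) \<Rightarrow> 'a \<Rightarrow> real" where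
  "rescale \<gamma> \<phi> x = (1 / \<gamma> ^ DIM('a)) * \<phi> ((1 / \<gamma>) *\<^sub>R x)"

definition dirac_delta :: "'a::euclidean_space distribution" where
  "dirac_delta g = g 0"

definition mollifier :: "('a::euclidean_space \<Rightarrow> real) \<Rightarrow> bool" where
  "mollifier \<phi> \<longleftrightarrow> test_function \<phi> \<and> (\<integral>x. \<phi> x \<partial>lebesgue) = 1 \<and>
     distributional_limit (\<lambda>\<gamma>. rescale \<gamma> \<phi>) dirac_delta"

definition convolution ::
    "('a::euclidean_space \<Rightarrow> real) \<Rightarrow> 'a distribution \<Rightarrow> 'a \<Rightarrow> real" where
  "convolution g T y = T (\<lambda>x. g (y - x))"

end

theory Submission
  imports Defs
begin

text \<open>
  Two facts make the theorem true: a locally Lipschitz function is differentiable almost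
  everywhere (Rademacher), and its derivative in the direction \<open>w\<close>, which then exists almost
  everywhere, can be integrated by parts against compactly supported locally Lipschitz functions
  (lemma \<open>dirder_integration_by_parts\<close>: compare difference quotients under a translation and
  pass to the limit).

  The statement about differentiability on almost all lines is Rademacher's theorem and Fubini's
  theorem in the coordinates \<open>(z, t) \<mapsto> z + t w\<close> (lemma \<open>AE_lines_iff\<close>).

  The distributional limit exists on every line \<open>z + \<real> w\<close>. Write \<open>\<phi>\<^sub>2\<close> for the second
  derivative of \<open>\<phi>\<close> in the direction \<open>w\<close> and \<open>n\<close> for the dimension. Integration by parts in
  \<open>n\<close> variables moves one derivative off \<open>f\<close> in the convolution, so that its value at
  \<open>z + t w\<close> is \<open>\<integral> f(x) \<gamma>\<^bsup>-n-2\<^esup> \<phi>\<^sub>2((z + t w - x) / \<gamma>) dx\<close> (lemma \<open>convolution_D2\<close>).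
  Integrate this against a test function \<open>g(t)\<close>, exchange the two integrals and integrate by
  parts twice in \<open>t\<close>. The derivatives move to \<open>g\<close>, and the pairing becomes
  \<open>\<integral> g''(t) \<integral> f(z + t w - \<gamma> u) \<phi>(u) du dt\<close> (lemma \<open>convolution_D2_line_pairing\<close>). Since \<open>f\<close>
  is continuous and \<open>\<phi>\<close> has integral 1, this tends to \<open>\<integral> g''(t) f(z + t w) dt\<close>, which is
  the value of the distributional second derivative of \<open>t \<mapsto> f(z + t w)\<close> at \<open>g\<close>.

  Rademacher's theorem is proved along classical lines. On the real line, the difference
  quotients cannot oscillate on a set of positive measure, by Vitali's covering theorem (lemmas
  \<open>vitali_compare\<close>, \<open>lipschitz_real_AE_differentiable\<close>). Fubini's theorem gives all directional
  derivatives almost everywhere. Their additivity in the direction holds almost everywhere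
  because it holds after integration against continuous compactly supported functions (lemma
  \<open>AE_dirder_add\<close>). The Lipschitz condition then upgrades a linear family of directional
  derivatives in a countable dense set of directions to total differentiability.
\<close>

section \<open>Lipschitz functions on the real line\<close>

text \<open>If \<open>M \<le> k N\<close> on arbitrarily small balls around every point of \<open>S\<close>, then Vitali's theorem
  gives \<open>M(S) \<le> k N(U)\<close>: countably many disjoint such balls inside \<open>U\<close> cover \<open>S\<close> up to
  a Lebesgue null set, and \<open>M\<close> does not see that null set.\<close>

lemma vitali_compare:
  fixes M N :: "'a::euclidean_space measure" and S U :: "'a set"
  assumes [measurable_cong]: "sets M = sets borel" "sets N = sets borel"
    and [measurable]: "S \<in> sets borel" "U \<in> sets borel"
    and ac: "\<And>A. A \<in> null_sets lborel \<Longrightarrow> A \<in> null_sets M"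
    and fine: "\<And>x d. x \<in> S \<Longrightarrow> 0 < d \<Longrightarrow> \<exists>c r. 0 < r \<and> r < d \<and> x \<in> cball c r \<and> cball c r \<subseteq> U
        \<and> emeasure M (cball c r) \<le> k * emeasure N (cball c r)"
  shows "emeasure M S \<le> k * emeasure N U"
proof -
  define K where "K = {(c, r). 0 < r \<and> cball c r \<subseteq> U
        \<and> emeasure M (cball c r) \<le> k * emeasure N (cball c r)}"
  obtain C where C: "countable C" "C \<subseteq> K"
    and disj: "pairwise (\<lambda>i j. disjnt (cball (fst i) (snd i)) (cball (fst j) (snd j))) C"
    and neg: "negligible (S - (\<Union>i\<in>C. cball (fst i) (snd i)))"
  proof (rule Vitali_covering_theorem_cballs[of K snd S fst])
    show "\<exists>i. i \<in> K \<and> x \<in> cball (fst i) (snd i) \<and> snd i < d" if xd: "x \<in> S" "0 < d" for x d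
    proof -
      obtain c r where "0 < r" "r < d" "x \<in> cball c r" "cball c r \<subseteq> U"
          "emeasure M (cball c r) \<le> k * emeasure N (cball c r)"
        using fine[OF xd] by blast
      then show ?thesis
        by (intro exI[of _ "(c, r)"]) (simp add: K_def)
    qed
    show "0 < snd i" if "i \<in> K" for i
      using that by (auto simp: K_def)
  qed
  define B where "B i = cball (fst i) (snd i)" for i :: "'a \<times> real"
  have [measurable]: "B i \<in> sets borel" for i
    by (simp add: B_def)
  have Um[measurable]: "(\<Union>i\<in>C. B i) \<in> sets borel"
    using C(1) by (intro sets.countable_UN'') auto
  have dis: "disjoint_family_on B C"
    using disj by (auto simp: disjoint_family_on_def pairwise_def disjnt_def B_def)
  have "S - (\<Union>i\<in>C. B i) \<in> null_sets lborel"
    using neg by (simp add: negligible_iff_null_sets null_sets_completion_iff B_def[symmetric])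
  then have nul: "emeasure M (S - (\<Union>i\<in>C. B i)) = 0"
    using ac by blast
  have "emeasure M S \<le> emeasure M ((\<Union>i\<in>C. B i) \<union> (S - (\<Union>i\<in>C. B i)))"
    by (intro emeasure_mono) auto
  also have "\<dots> \<le> emeasure M (\<Union>i\<in>C. B i) + emeasure M (S - (\<Union>i\<in>C. B i))"
    by (intro emeasure_subadditive) auto
  also have "\<dots> = (\<integral>\<^sup>+i. emeasure M (B i) \<partial>count_space C)"
    using nul dis C(1) by (simp add: emeasure_UN_countable assms(1))
  also have "\<dots> \<le> (\<integral>\<^sup>+i. k * emeasure N (B i) \<partial>count_space C)"
    using C(2) by (intro nn_integral_mono) (auto simp: K_def B_def)
  also have "\<dots> = k * emeasure N (\<Union>i\<in>C. B i)"
    using dis C(1) by (simp add: emeasure_UN_countable assms(2) nn_integral_cmult)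
  also have "\<dots> \<le> k * emeasure N U"
  proof (intro mult_left_mono emeasure_mono)
    have "B i \<subseteq> U" if "i \<in> C" for i
    proof -
      have "i \<in> K" using that C(2) by blast
      then show ?thesis by (simp add: K_def B_def case_prod_beta)
    qed
    then show "(\<Union>i\<in>C. B i) \<subseteq> U" by blast
  qed (simp_all add: assms(2))
  finally show ?thesis .
qed

text \<open>A bounded real function that does not converge oscillates across a gap between two rational
  numbers. Such gaps are countable, and each can be treated separately.\<close>

lemma tendsto_if_not_oscillating:
  fixes q :: "'a \<Rightarrow> real"
  assumes "F \<noteq> bot" and lo: "eventually (\<lambda>s. a < q s) F" and hi: "eventually (\<lambda>s. q s \<le> b) F"
    and osc: "\<And>r R. r \<in> \<rat> \<Longrightarrow> R \<in> \<rat> \<Longrightarrow> a < r \<Longrightarrow> r < R \<Longrightarrow>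
      \<not> ((\<exists>\<^sub>F s in F. q s < r) \<and> (\<exists>\<^sub>F s in F. q s > R))"
  shows "\<exists>l. (q \<longlongrightarrow> l) F"
proof -
  define C where "C = {c. eventually (\<lambda>s. c < q s) F}"
  have aC: "a \<in> C" using lo by (simp add: C_def)
  have bC: "c \<le> b" if "c \<in> C" for c
  proof -
    have "eventually (\<lambda>s. c < b) F"
      using that hi unfolding C_def by (auto elim: eventually_elim2)
    then show ?thesis using \<open>F \<noteq> bot\<close> by (auto simp: eventually_const_iff)
  qed
  then have bdd: "bdd_above C" by (auto simp: bdd_above_def)
  have aS: "a \<le> Sup C" by (rule cSup_upper[OF aC bdd])
  show ?thesis
  proof (intro exI[of _ "Sup C"] order_tendstoI)
    fix c assume "c < Sup C"
    then obtain c' where "c' \<in> C" "c < c'"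
      using less_cSup_iff[of C c] aC bdd by auto
    then show "eventually (\<lambda>s. c < q s) F"
      unfolding C_def by (auto elim: eventually_mono)
  next
    fix c assume "Sup C < c"
    then obtain R where R: "R \<in> \<rat>" "Sup C < R" "R < c" using Rats_dense_in_real by blast
    then obtain r where r: "r \<in> \<rat>" "Sup C < r" "r < R" using Rats_dense_in_real by blast
    then obtain r' where r': "Sup C < r'" "r' < r" using dense by blast
    have "r' \<notin> C" using cSup_upper[OF _ bdd] r' by force
    then have "\<exists>\<^sub>F s in F. q s < r"
      unfolding C_def using r' by (auto simp: not_eventually elim!: frequently_elim1)
    then have "\<not> (\<exists>\<^sub>F s in F. q s > R)"
      using osc[OF r(1) R(1)] aS r by auto
    then show "eventually (\<lambda>s. q s < c) F"
      unfolding not_frequently using R by (auto elim: eventually_mono)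
  qed
qed

text \<open>Only the countably many scales \<open>1 / (n + 1)\<close> matter, and at each scale the union over the
  uncountably many increments \<open>s\<close> is harmless because it is a union of open sets.\<close>

lemma frequently_at_0_sets_borel:
  fixes q :: "real \<Rightarrow> 'a::topological_space \<Rightarrow> bool"
  assumes "\<And>s. s \<noteq> 0 \<Longrightarrow> open {x. q s x}"
  shows "{x. \<exists>\<^sub>F s in at 0. q s x} \<in> sets borel"
proof -
  have 1: "(\<exists>\<^sub>F s in at 0. q s x) \<longleftrightarrow> (\<forall>n::nat. \<exists>s. s \<noteq> 0 \<and> \<bar>s\<bar> < 1 / Suc n \<and> q s x)" for x
  proof -
    have "(\<exists>\<^sub>F s in at 0. q s x) \<longleftrightarrow> (\<forall>d>0. \<exists>s. s \<noteq> 0 \<and> \<bar>s\<bar> < d \<and> q s x)"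
      by (auto simp: frequently_def eventually_at dist_real_def)
    also have "\<dots> \<longleftrightarrow> (\<forall>n::nat. \<exists>s. s \<noteq> 0 \<and> \<bar>s\<bar> < 1 / Suc n \<and> q s x)"
    proof safe
      fix d :: real assume *: "\<forall>n::nat. \<exists>s. s \<noteq> 0 \<and> \<bar>s\<bar> < 1 / Suc n \<and> q s x" and "0 < d"
      then obtain n where "1 / Suc n < d" using nat_approx_posE by blast
      then show "\<exists>s. s \<noteq> 0 \<and> \<bar>s\<bar> < d \<and> q s x" using *[rule_format, of n] by auto
    qed auto
    finally show ?thesis .
  qed
  have "{x. \<exists>\<^sub>F s in at 0. q s x} = (\<Inter>n::nat. \<Union>s\<in>{s. s \<noteq> 0 \<and> \<bar>s\<bar> < 1 / Suc n}. {x. q s x})"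
    unfolding 1 by auto
  moreover have "open (\<Union>s\<in>{s. s \<noteq> 0 \<and> \<bar>s\<bar> < 1 / Suc n}. {x. q s x})" for n :: nat
    using assms by (intro open_UN) auto
  ultimately show ?thesis by auto
qed

lemma borel_outer_open:
  assumes "S \<in> sets (borel :: 'a::euclidean_space measure)" "e > 0"
  obtains T where "open T" "S \<subseteq> T" "emeasure lborel T \<le> emeasure lborel S + ennreal e"
proof -
  have S: "S \<in> sets lebesgue" using assms(1) by auto
  obtain T where T: "open T" "S \<subseteq> T" "emeasure lebesgue (T - S) < ennreal e"
    using sets_lebesgue_outer_open[OF S assms(2)] by metis
  have "emeasure lborel T = emeasure lborel (S \<union> (T - S))"
    using T by (intro arg_cong2[where f=emeasure]) auto
  also have "\<dots> = emeasure lborel S + emeasure lborel (T - S)"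
    using T assms(1) by (intro plus_emeasure[symmetric]) auto
  also have "\<dots> \<le> emeasure lborel S + ennreal e"
    using T assms(1) by (intro add_left_mono) auto
  finally show thesis using T that by blast
qed

text \<open>Adding a linear function turns \<open>h\<close> into an increasing bi-Lipschitz homeomorphism \<open>F\<close> of the
  line. The difference quotients of \<open>F\<close> are the ratios \<open>\<mu>(I) / \<bar>I\<bar>\<close> for the measure
  \<open>\<mu>(A) = \<bar>F(A)\<bar>\<close> and intervals \<open>I\<close>. On the set \<open>S\<close> of points of a bounded region where they are
  below \<open>r\<close> and above \<open>R\<close> at arbitrarily small scales, comparison in both directions gives
  \<open>R \<bar>S\<bar> \<le> \<mu>(S) \<le> r \<bar>S\<bar>\<close>, so \<open>S\<close> is null if \<open>r < R\<close>.\<close>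

lemma lipschitz_real_AE_differentiable:
  fixes h :: "real \<Rightarrow> real"
  assumes h: "L-lipschitz_on UNIV h"
  shows "AE x in lborel. h differentiable (at x)"
proof -
  have L: "0 \<le> L" using h lipschitz_on_nonneg by blast
  \<comment> \<open>The slope \<open>L + 1\<close> makes all difference quotients of \<open>F\<close> at least 1.\<close>
  define F where "F x = h x + (L + 1) * x" for x
  have hb: "\<bar>h y - h x\<bar> \<le> L * \<bar>y - x\<bar>" for x y
    using lipschitz_onD[OF h, of y x] by (simp add: dist_real_def)
  have F1: "y - x \<le> F y - F x" and F2: "F y - F x \<le> (2 * L + 1) * (y - x)" if "x \<le> y" for x y
    using hb[of y x] that by (auto simp: F_def algebra_simps abs_le_iff)
  have contF: "continuous_on UNIV F"
    unfolding F_def using lipschitz_on_continuous_on[OF h] by (intro continuous_intros) auto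
  have injF: "inj F"
  proof (rule linorder_injI)
    show "F x \<noteq> F y" if "x < y" for x y using F1[of x y] that by auto
  qed
  have surjF: "surj F"
  proof -
    have "\<exists>x. F x = c" for c
    proof -
      define k where "k = \<bar>c - F 0\<bar>"
      have "F (- k) \<le> c" "c \<le> F k"
        using F1[of "-k" 0] F1[of 0 k] unfolding k_def by auto
      then show ?thesis
        using IVT'[of F "-k" c k] continuous_on_subset[OF contF] unfolding k_def by auto
    qed
    then show ?thesis by (metis surjI)
  qed
  define G where "G = inv F"
  have GF[simp]: "G (F x) = x" and FG[simp]: "F (G x) = x" for x
    using injF surjF by (auto simp: G_def surj_f_inv_f)
  have F_le: "F x \<le> F y \<longleftrightarrow> x \<le> y" for x y
    using F1[of x y] F1[of y x] by linarith
  have contG: "continuous_on UNIV G"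
  proof -
    have "1-lipschitz_on UNIV G"
    proof (rule lipschitz_onI)
      fix x y
      show "dist (G x) (G y) \<le> 1 * dist x y"
        using F1[of "G x" "G y"] F1[of "G y" "G x"]
        by (cases "G x \<le> G y") (auto simp: dist_real_def)
    qed simp
    then show ?thesis by (rule lipschitz_on_continuous_on)
  qed
  then have Gm[measurable]: "G \<in> borel_measurable borel" by (rule borel_measurable_continuous_onI)
  have Gv: "G -` A = F ` A" for A
  proof safe
    fix x assume "G x \<in> A"
    then have "F (G x) \<in> F ` A" by (rule imageI)
    then show "x \<in> F ` A" by simp
  qed simp
  \<comment> \<open>Pushing Lebesgue measure forward along \<open>G\<close> measures \<open>A\<close> by the length of \<open>F ` A\<close>.\<close>
  define \<mu> where "\<mu> = distr lborel borel G"
  have [measurable_cong, simp]: "sets \<mu> = sets borel" by (simp add: \<mu>_def)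
  have em: "emeasure \<mu> A = emeasure lborel (G -` A)" if "A \<in> sets borel" for A
    using that by (simp add: \<mu>_def emeasure_distr)
  have em_cball: "emeasure \<mu> (cball c r) = ennreal (F (c + r) - F (c - r))" if "r > 0" for c r
  proof -
    have "G -` {c - r..c + r} = {F (c - r)..F (c + r)}"
      using F_le[of "c - r" "G _"] F_le[of "G _" "c + r"] by auto
    moreover have "F (c - r) \<le> F (c + r)" using that by (simp add: F_le)
    ultimately show ?thesis by (simp add: em cball_eq_atLeastAtMost)
  qed
  have ball_len: "emeasure lborel (cball c r) = ennreal (2 * r)" if "r > 0" for c r :: real
    using that by (simp add: cball_eq_atLeastAtMost)
  have ac: "A \<in> null_sets \<mu>" if A: "A \<in> null_sets lborel" for A
  proof -
    have "negligible A" using A by (simp add: negligible_iff_null_sets null_sets_completionI)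
    then have "negligible (F ` A)"
    proof (rule negligible_locally_Lipschitz_image[rotated])
      show "\<exists>T B. open T \<and> x \<in> T \<and> (\<forall>y\<in>A \<inter> T. norm (F y - F x) \<le> B * norm (y - x))" for x
      proof (intro exI[of _ UNIV] exI[of _ "2 * L + 1"] conjI ballI)
        show "norm (F y - F x) \<le> (2 * L + 1) * norm (y - x)" for y
          using F1[of x y] F1[of y x] F2[of x y] F2[of y x] by (cases "x \<le> y") auto
      qed auto
    qed simp
    moreover have "G -` A \<in> sets borel" using A by (intro measurable_sets_borel[OF Gm]) auto
    ultimately have "G -` A \<in> null_sets lborel"
      by (simp add: Gv negligible_iff_null_sets null_sets_completion_iff)
    then show ?thesis using A by (auto simp: em null_sets_def)
  qed
  define q where "q x s = (F (x + s) - F x) / s" for x s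
  define E where "E r R = {x. (\<exists>\<^sub>F s in at 0. q x s < r) \<and> (\<exists>\<^sub>F s in at 0. q x s > R)}" for r R
  have qcont: "continuous_on UNIV (\<lambda>x. q x s)" for s
    unfolding q_def divide_inverse by (intro continuous_intros continuous_on_compose2[OF contF]) auto
  have Em[measurable]: "E r R \<in> sets borel" for r R
  proof -
    have "{x. \<exists>\<^sub>F s in at 0. q x s < r} \<in> sets borel"
      by (intro frequently_at_0_sets_borel open_Collect_less qcont continuous_intros)
    moreover have "{x. \<exists>\<^sub>F s in at 0. q x s > R} \<in> sets borel"
      by (intro frequently_at_0_sets_borel open_Collect_less qcont continuous_intros)
    ultimately have "{x. \<exists>\<^sub>F s in at 0. q x s < r} \<inter> {x. \<exists>\<^sub>F s in at 0. q x s > R} \<in> sets borel"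
      by (rule sets.Int)
    then show ?thesis by (simp add: E_def Collect_conj_eq)
  qed
  \<comment> \<open>A difference quotient at \<open>x\<close> with a small increment \<open>s\<close> belongs to the closed ball with
    end points \<open>x\<close> and \<open>x + s\<close>, which has radius \<open>\<bar>s\<bar> / 2\<close>.\<close>
  have interval: "\<exists>c \<rho>. 0 < \<rho> \<and> \<rho> < d \<and> x \<in> cball c \<rho> \<and> cball c \<rho> \<subseteq> T \<and>
      P ((F (c + \<rho>) - F (c - \<rho>)) / (2 * \<rho>))"
    if fr: "\<exists>\<^sub>F s in at 0. P (q x s)" and T: "open T" "x \<in> T" and d: "d > 0" for x d T P
  proof -
    obtain e where e: "e > 0" "ball x e \<subseteq> T" using T open_contains_ball by blast
    have "\<exists>s. s \<noteq> 0 \<and> \<bar>s\<bar> < d' \<and> P (q x s)" if "d' > 0" for d'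
      using fr that unfolding frequently_def eventually_at by (auto simp: dist_real_def)
    from this[of "min d e"] have "\<exists>s. s \<noteq> 0 \<and> \<bar>s\<bar> < min d e \<and> P (q x s)"
      using d e(1) by simp
    then obtain s where s: "s \<noteq> 0" "\<bar>s\<bar> < min d e" "P (q x s)" by blast
    have "cball (x + s / 2) (\<bar>s\<bar> / 2) \<subseteq> T"
      using s(2) e(2) by (force simp: dist_real_def abs_if split: if_splits)
    moreover have "(F (x + s/2 + \<bar>s\<bar>/2) - F (x + s/2 - \<bar>s\<bar>/2)) / (2 * (\<bar>s\<bar>/2)) = q x s"
    proof (cases "s > 0")
      case True
      then have e: "x + s/2 + \<bar>s\<bar>/2 = x + s" "x + s/2 - \<bar>s\<bar>/2 = x" "2 * (\<bar>s\<bar>/2) = s" by auto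
      show ?thesis unfolding e q_def ..
    next
      case False
      then have e: "x + s/2 + \<bar>s\<bar>/2 = x" "x + s/2 - \<bar>s\<bar>/2 = x + s" "2 * (\<bar>s\<bar>/2) = - s" using s by auto
      show ?thesis unfolding e q_def using s by (simp add: divide_simps)
    qed
    ultimately show ?thesis using s
      by (intro exI[of _ "x + s/2"] exI[of _ "\<bar>s\<bar>/2"]) (auto simp: dist_real_def)
  qed
  have E0: "emeasure lborel (E r R \<inter> ball 0 (real n)) = 0" if r: "0 < r" "r < R" for r R n
  proof -
    define S where "S = E r R \<inter> ball 0 (real n)"
    have Sm[measurable]: "S \<in> sets borel" by (auto simp: S_def)
    have S_E: "x \<in> E r R" if "x \<in> S" for x using that by (simp add: S_def)
    have fin: "emeasure lborel S < \<infinity>"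
    proof -
      have "emeasure lborel S \<le> emeasure lborel (ball (0::real) (real n))"
        by (auto simp: S_def intro!: emeasure_mono)
      then show ?thesis
        using emeasure_lborel_ball_finite[of "0::real" "real n"] le_less_trans by blast
    qed
    have up: "emeasure \<mu> S \<le> ennreal r * emeasure lborel S"
    proof (rule ennreal_le_epsilon)
      fix e :: real assume "0 < e"
      then obtain T where T: "open T" "S \<subseteq> T" "emeasure lborel T \<le> emeasure lborel S + ennreal (e/r)"
        using borel_outer_open[OF Sm, of "e/r"] r by auto
      have "emeasure \<mu> S \<le> ennreal r * emeasure lborel T"
      proof (rule vitali_compare)
        fix x d :: real assume x: "x \<in> S" and d: "0 < d"
        obtain c \<rho> where c: "0 < \<rho>" "\<rho> < d" "x \<in> cball c \<rho>" "cball c \<rho> \<subseteq> T"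
            "(F (c + \<rho>) - F (c - \<rho>)) / (2 * \<rho>) < r"
          using interval[of "\<lambda>y. y < r" x T d] S_E[OF x] x T d by (auto simp: E_def)
        then have "ennreal (F (c + \<rho>) - F (c - \<rho>)) \<le> ennreal (r * (2 * \<rho>))"
          by (intro ennreal_leI) (simp add: field_simps)
        then have "emeasure \<mu> (cball c \<rho>) \<le> ennreal r * emeasure lborel (cball c \<rho>)"
          using c r by (simp add: em_cball ball_len ennreal_mult[symmetric])
        then show "\<exists>c \<rho>. 0 < \<rho> \<and> \<rho> < d \<and> x \<in> cball c \<rho> \<and> cball c \<rho> \<subseteq> T \<and>
            emeasure \<mu> (cball c \<rho>) \<le> ennreal r * emeasure lborel (cball c \<rho>)"
          using c by blast
      qed (use T ac in auto)
      also have "\<dots> \<le> ennreal r * (emeasure lborel S + ennreal (e/r))"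
        by (intro mult_left_mono T) auto
      also have "\<dots> = ennreal r * emeasure lborel S + ennreal e"
        using r \<open>0 < e\<close> by (simp add: distrib_left ennreal_mult[symmetric])
      finally show "emeasure \<mu> S \<le> ennreal r * emeasure lborel S + ennreal e" .
    qed
    have down: "emeasure lborel S \<le> ennreal (1 / R) * emeasure \<mu> S"
    proof (rule ennreal_le_epsilon)
      fix e :: real assume e: "0 < e"
      have GS: "G -` S \<in> sets borel" by (intro measurable_sets_borel[OF Gm]) auto
      \<comment> \<open>A neighbourhood of \<open>S\<close> with small excess for \<open>\<mu>\<close> is the preimage of a neighbourhood
        of \<open>F ` S\<close> with small excess for Lebesgue measure.\<close>
      obtain V where V: "open V" "G -` S \<subseteq> V"
          "emeasure lborel V \<le> emeasure lborel (G -` S) + ennreal (e * R)"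
        using borel_outer_open[OF GS, of "e * R"] r e by auto
      define T where "T = F -` V"
      have T: "open T" "S \<subseteq> T"
        using V contF by (auto simp: T_def open_vimage Gv)
      have "G -` T = V" by (auto simp: T_def)
      then have T\<mu>: "emeasure \<mu> T \<le> emeasure \<mu> S + ennreal (e * R)"
        using V T by (simp add: em)
      have "emeasure lborel S \<le> ennreal (1 / R) * emeasure \<mu> T"
      proof (rule vitali_compare)
        fix x d :: real assume x: "x \<in> S" and d: "0 < d"
        obtain c \<rho> where c: "0 < \<rho>" "\<rho> < d" "x \<in> cball c \<rho>" "cball c \<rho> \<subseteq> T"
            "R < (F (c + \<rho>) - F (c - \<rho>)) / (2 * \<rho>)"
          using interval[of "\<lambda>y. R < y" x T d] S_E[OF x] x T d by (auto simp: E_def)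
        then have "ennreal (2 * \<rho>) \<le> ennreal (1 / R * (F (c + \<rho>) - F (c - \<rho>)))"
          using r by (intro ennreal_leI) (simp add: field_simps)
        moreover have "0 \<le> F (c + \<rho>) - F (c - \<rho>)" using c by (simp add: F_le)
        ultimately have "emeasure lborel (cball c \<rho>) \<le> ennreal (1 / R) * emeasure \<mu> (cball c \<rho>)"
          using c r by (simp add: em_cball ball_len ennreal_mult[symmetric])
        then show "\<exists>c \<rho>. 0 < \<rho> \<and> \<rho> < d \<and> x \<in> cball c \<rho> \<and> cball c \<rho> \<subseteq> T \<and>
            emeasure lborel (cball c \<rho>) \<le> ennreal (1 / R) * emeasure \<mu> (cball c \<rho>)"
          using c by blast
      qed (use T in auto)
      also have "\<dots> \<le> ennreal (1 / R) * (emeasure \<mu> S + ennreal (e * R))"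
        by (intro mult_left_mono T\<mu>) auto
      also have "\<dots> = ennreal (1 / R) * emeasure \<mu> S + ennreal e"
        using r e by (simp add: distrib_left ennreal_mult[symmetric])
      finally show "emeasure lborel S \<le> ennreal (1 / R) * emeasure \<mu> S + ennreal e" .
    qed
    obtain m where m: "emeasure lborel S = ennreal m" "0 \<le> m"
      using fin by (cases "emeasure lborel S") auto
    have "ennreal m \<le> ennreal (1 / R) * (ennreal r * ennreal m)"
      using down mult_left_mono[OF up, of "ennreal (1/R)"] m by (auto intro: order_trans)
    also have "\<dots> = ennreal (r / R * m)"
      using r m by (simp add: ennreal_mult[symmetric])
    finally have "m \<le> r / R * m"
      using r m by (subst (asm) ennreal_le_iff) auto
    then have "R * m \<le> r * m" using r by (simp add: field_simps)
    then have "m = 0" using r m by (simp add: mult_le_cancel_right)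
    then show ?thesis using m by (simp add: S_def)
  qed
  have AE1: "AE x in lborel. x \<notin> E r R" if "0 < r" "r < R" for r R
  proof -
    have "AE x in lborel. \<forall>n. x \<notin> E r R \<inter> ball 0 (real n)"
      unfolding AE_all_countable
      by (intro allI AE_not_in null_setsI E0 that) auto
    then show ?thesis
    proof eventually_elim
      case (elim x)
      obtain n where "\<bar>x\<bar> < real n" using reals_Archimedean2 by blast
      then show ?case using elim[rule_format, of n] by (auto simp: dist_real_def)
    qed
  qed
  have "AE x in lborel. \<forall>r\<in>\<rat>. \<forall>R\<in>\<rat>. 0 < r \<and> r < R \<longrightarrow> x \<notin> E r R"
    using AE1 by (intro AE_ball_countable[THEN iffD2] ballI countable_rat) auto
  then show ?thesis
  proof eventually_elim
    case (elim x)
    have b: "1 \<le> q x s \<and> q x s \<le> 2 * L + 1" if "s \<noteq> 0" for s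
      using F1[of x "x + s"] F1[of "x + s" x] F2[of x "x + s"] F2[of "x + s" x] that
      by (cases "s > 0") (auto simp: q_def field_simps)
    have ev: "\<forall>\<^sub>F s in at 0. s \<noteq> (0::real)" by (simp add: eventually_at_filter)
    have "\<exists>l. (q x \<longlongrightarrow> l) (at 0)"
    proof (rule tendsto_if_not_oscillating[where a=0 and b="2 * L + 1"])
      show "\<forall>\<^sub>F s in at 0. 0 < q x s" using ev by eventually_elim (use b in force)
      show "\<forall>\<^sub>F s in at 0. q x s \<le> 2 * L + 1" using ev by eventually_elim (use b in force)
    qed (use elim in \<open>auto simp: E_def\<close>)
    then obtain l where "((\<lambda>s. (F (x + s) - F x) / s) \<longlongrightarrow> l) (at 0)" unfolding q_def by blast
    then have "DERIV F x :> l" by (simp add: DERIV_def)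
    then have "DERIV (\<lambda>x. F x - (L + 1) * x) x :> l - (L + 1)"
      by (auto intro!: derivative_eq_intros)
    then have "DERIV h x :> l - (L + 1)" by (simp add: F_def)
    then show ?case using real_differentiable_def by blast
  qed
qed

section \<open>Locally Lipschitz functions and Lebesgue measure on lines\<close>

lemma locally_lipschitz_continuous_on:
  fixes f :: "'a::metric_space \<Rightarrow> 'b::metric_space"
  assumes "locally_lipschitz f"
  shows "continuous_on UNIV f"
proof (rule continuous_at_imp_continuous_on, rule ballI)
  fix x
  obtain u L where u: "u > 0" "L-lipschitz_on (cball x u) f"
    using assms unfolding locally_lipschitz_def by blast
  then have "continuous_on (cball x u) f" by (rule_tac lipschitz_on_continuous_on)
  then show "isCont f x"
    using u(1) by (intro continuous_on_interior[of "cball x u" f x])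
      (auto intro: subsetD[OF interior_mono[OF ball_subset_cball[of x u]]] simp: interior_open)
qed

lemma locally_lipschitz_on_compact:
  fixes f :: "'a::metric_space \<Rightarrow> 'b::metric_space"
  assumes "locally_lipschitz f" "compact K"
  obtains L where "L-lipschitz_on K f"
proof -
  have "local_lipschitz {0::real} K (\<lambda>_. f)"
  proof (rule local_lipschitzI)
    fix t x assume "t \<in> {0::real}" "x \<in> K"
    obtain u L where u: "u > 0" "L-lipschitz_on (cball x u) f"
      using assms(1) unfolding locally_lipschitz_def by blast
    then show "\<exists>u>0. \<exists>L. \<forall>t\<in>cball t u \<inter> {0}. L-lipschitz_on (cball x u \<inter> K) f"
      by (intro exI[of _ u] conjI exI[of _ L] ballI) (auto intro: lipschitz_on_subset)
  qed
  then obtain L where "\<And>t. t \<in> {0::real} \<Longrightarrow> L-lipschitz_on K f"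
    using local_lipschitz_compact_implies_lipschitz[of "{0::real}" K "\<lambda>_. f"] assms(2) by auto
  then show thesis using that by auto
qed

lemma locally_lipschitz_compose:
  fixes f :: "'b::metric_space \<Rightarrow> 'c::metric_space" and p :: "'a::metric_space \<Rightarrow> 'b"
  assumes f: "locally_lipschitz f" and p: "K-lipschitz_on UNIV p"
  shows "locally_lipschitz (\<lambda>x. f (p x))"
  unfolding locally_lipschitz_def
proof
  fix x
  have K: "0 \<le> K" using p by (rule lipschitz_on_nonneg)
  obtain u L where u: "u > 0" "L-lipschitz_on (cball (p x) u) f"
    using f unfolding locally_lipschitz_def by blast
  define d where "d = u / (K + 1)"
  have d: "d > 0" "K * d \<le> u" using u(1) K by (auto simp: d_def field_simps add_nonneg_pos)
  have "p ` cball x d \<subseteq> cball (p x) u"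
  proof safe
    fix y assume "y \<in> cball x d"
    then have "K * dist x y \<le> K * d" using K by (intro mult_left_mono) auto
    then show "p y \<in> cball (p x) u"
      using lipschitz_onD[OF p, of x y] d(2) by simp
  qed
  then have "L-lipschitz_on (p ` cball x d) f" by (rule lipschitz_on_subset[OF u(2)])
  moreover have "K-lipschitz_on (cball x d) p" by (rule lipschitz_on_subset[OF p]) simp
  ultimately have "(L * K)-lipschitz_on (cball x d) (f \<circ> p)" by (intro lipschitz_on_compose)
  then show "\<exists>u>0. \<exists>L. L-lipschitz_on (cball x u) (\<lambda>x. f (p x))"
    using d(1) by (auto simp: o_def)
qed

lemma locally_lipschitz_line:
  fixes f :: "'a::real_normed_vector \<Rightarrow> 'b::metric_space"
  assumes f: "locally_lipschitz f"
  shows "locally_lipschitz (\<lambda>t. f (z + t *\<^sub>R w))"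
proof (rule locally_lipschitz_compose[OF f])
  show "(norm w)-lipschitz_on UNIV (\<lambda>t. z + t *\<^sub>R w)"
    by (rule lipschitz_onI) (simp_all add: dist_norm scaleR_diff_left[symmetric] mult.commute)
qed

lemma locally_lipschitz_real_AE_differentiable:
  fixes h :: "real \<Rightarrow> real"
  assumes h: "locally_lipschitz h"
  shows "AE x in lborel. h differentiable (at x)"
proof -
  \<comment> \<open>Composition with the retraction onto \<open>[-n, n]\<close> makes \<open>h\<close> globally Lipschitz and does not
    change it on \<open>(-n, n)\<close>.\<close>
  define c where "c n x = max (- real n) (min (real n) x)" for n x
  have "AE x in lborel. (h \<circ> c n) differentiable (at x)" for n
  proof -
    obtain L where L: "L-lipschitz_on {- real n..real n} h"
      using locally_lipschitz_on_compact[OF h, of "{- real n..real n}"] by auto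
    have c1: "1-lipschitz_on UNIV (c n)"
      by (rule lipschitz_onI) (auto simp: c_def dist_real_def)
    have "L-lipschitz_on (range (c n)) h"
      by (rule lipschitz_on_subset[OF L]) (auto simp: c_def)
    then have "(L * 1)-lipschitz_on UNIV (h \<circ> c n)"
      using c1 by (intro lipschitz_on_compose)
    then show ?thesis by (rule lipschitz_real_AE_differentiable)
  qed
  then have "AE x in lborel. \<forall>n. (h \<circ> c n) differentiable (at x)"
    by (simp add: AE_all_countable)
  then show ?thesis
  proof eventually_elim
    case (elim x)
    obtain n where n: "\<bar>x\<bar> < real n" using reals_Archimedean2 by blast
    have "(h \<circ> c n) differentiable (at x)" using elim by blast
    then obtain D where "((h \<circ> c n) has_derivative D) (at x)" by (auto simp: differentiable_def)
    then have "(h has_derivative D) (at x)"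
    proof (rule has_derivative_transform_within_open[where s="{- real n<..<real n}"])
      show "(h \<circ> c n) y = h y" if "y \<in> {- real n<..<real n}" for y
        using that by (simp add: c_def)
    qed (use n in auto)
    then show ?case by (auto simp: differentiable_def)
  qed
qed

lemma integral_lborel_affine:
  fixes f :: "'a::euclidean_space \<Rightarrow> real"
  assumes [measurable]: "f \<in> borel_measurable borel" and c: "c \<noteq> 0"
  shows "(\<integral>x. f x \<partial>lborel) = \<bar>c\<bar> ^ DIM('a) * (\<integral>x. f (t + c *\<^sub>R x) \<partial>lborel)"
proof -
  have "(\<integral>x. f x \<partial>lborel) =
      (\<integral>x. f x \<partial>density (distr lborel borel (\<lambda>x. t + c *\<^sub>R x)) (\<lambda>_. ennreal (\<bar>c\<bar> ^ DIM('a))))"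
    by (subst lborel_affine[OF c, of t]) (simp add: ennreal_power)
  also have "\<dots> = (\<integral>x. \<bar>c\<bar> ^ DIM('a) * f (t + c *\<^sub>R x) \<partial>lborel)"
    by (subst integral_density) (simp_all add: integral_distr)
  finally show ?thesis by simp
qed

lemma integral_lborel_translation:
  fixes f :: "'a::euclidean_space \<Rightarrow> real"
  assumes "f \<in> borel_measurable borel"
  shows "(\<integral>x. f (x + t) \<partial>lborel) = (\<integral>x. f x \<partial>lborel)"
  using integral_lborel_affine[OF assms, of 1 t] by (simp add: add.commute)

lemma AE_lborel_translation:
  fixes P :: "'a::euclidean_space \<Rightarrow> bool"
  assumes [measurable]: "Measurable.pred borel P"
  shows "(AE x in lborel. P (x + c)) \<longleftrightarrow> (AE x in lborel. P x)"
proof -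
  have "(AE x in lborel. P x) \<longleftrightarrow> (AE x in distr lborel borel ((+) c). P x)"
    by (subst lborel_distr_plus) (rule refl)
  also have "\<dots> \<longleftrightarrow> (AE x in lborel. P (c + x))"
    by (subst AE_distr_iff) auto
  finally show ?thesis by (simp add: add.commute)
qed

text \<open>By Fubini's theorem the left-hand side says that \<open>{z. \<not> P (z + t w)}\<close> is null for almost all
  \<open>t\<close>. These sets are translates of \<open>{z. \<not> P z}\<close>. No coordinates adapted to \<open>w\<close> are needed,
  and \<open>w = 0\<close> is not an exception.\<close>

lemma AE_lines_iff:
  fixes P :: "'a::euclidean_space \<Rightarrow> bool"
  assumes [measurable]: "Measurable.pred borel P"
  shows "(AE z in lborel. AE t in lborel. P (z + t *\<^sub>R w)) \<longleftrightarrow> (AE z in lborel. P z)"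
proof -
  have "(AE z in lborel. AE t in lborel. P (z + t *\<^sub>R w)) \<longleftrightarrow>
      (AE t in lborel. AE z in lborel. P (z + t *\<^sub>R w))"
    by (rule lborel_pair.AE_commute) measurable
  also have "\<dots> \<longleftrightarrow> (AE t in lborel :: real measure. AE z in lborel. P z)"
    by (simp add: AE_lborel_translation)
  also have "\<dots> \<longleftrightarrow> (AE z in lborel. P z)"
    by (subst eventually_const_iff) (simp_all add: ae_filter_eq_bot_iff)
  finally show ?thesis .
qed

section \<open>Directional derivatives\<close>

text \<open>The difference quotient of \<open>f\<close> at \<open>x\<close> in the direction \<open>v\<close> with increment \<open>s\<close>; it has the
  dummy value 0 for \<open>s = 0\<close>.\<close>

definition diff_quot :: "('a::real_vector \<Rightarrow> real) \<Rightarrow> 'a \<Rightarrow> real \<Rightarrow> 'a \<Rightarrow> real" where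
  "diff_quot f v s x = (f (x + s *\<^sub>R v) - f x) / s"

lemma continuous_on_diff_quot:
  fixes f :: "'a::real_normed_vector \<Rightarrow> real"
  assumes "continuous_on UNIV f"
  shows "continuous_on UNIV (diff_quot f v s)"
  unfolding diff_quot_def divide_inverse
  by (intro continuous_intros continuous_on_compose2[OF assms]) auto

lemma diff_quot_measurable:
  fixes f :: "'a::euclidean_space \<Rightarrow> real"
  assumes "continuous_on UNIV f"
  shows "diff_quot f v s \<in> borel_measurable borel"
  using continuous_on_diff_quot[OF assms] by (rule borel_measurable_continuous_onI)

lemma diff_quot_bounded:
  fixes f :: "'a::euclidean_space \<Rightarrow> real"
  assumes "locally_lipschitz f"
  obtains C where "0 \<le> C" "\<And>x s. norm x \<le> R \<Longrightarrow> \<bar>s\<bar> \<le> 1 \<Longrightarrow> \<bar>diff_quot f v s x\<bar> \<le> C"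
proof -
  obtain L where L: "L-lipschitz_on (cball 0 (R + norm v)) f"
    using locally_lipschitz_on_compact[OF assms, of "cball 0 (R + norm v)"] by auto
  have L0: "0 \<le> L" using L by (rule lipschitz_on_nonneg)
  show thesis
  proof (rule that[of "L * norm v"])
    fix x :: 'a and s :: real assume x: "norm x \<le> R" and s: "\<bar>s\<bar> \<le> 1"
    have "norm (x + s *\<^sub>R v) \<le> norm x + \<bar>s\<bar> * norm v" by (metis norm_scaleR norm_triangle_ineq)
    moreover have "\<bar>s\<bar> * norm v \<le> norm v" using s by (simp add: mult_left_le_one_le)
    ultimately have "\<bar>f (x + s *\<^sub>R v) - f x\<bar> \<le> L * dist (x + s *\<^sub>R v) x"
      using x lipschitz_onD[OF L, of "x + s *\<^sub>R v" x] by (simp add: dist_real_def add_increasing2)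
    then have "\<bar>f (x + s *\<^sub>R v) - f x\<bar> \<le> (L * norm v) * \<bar>s\<bar>"
      by (simp add: dist_norm mult_ac)
    then show "\<bar>diff_quot f v s x\<bar> \<le> L * norm v"
      using L0 by (cases "s = 0") (auto simp: diff_quot_def abs_divide divide_le_eq)
  qed (use L0 in simp)
qed

lemma AE_directional_derivative_exists:
  fixes f :: "'a::euclidean_space \<Rightarrow> real"
  assumes f: "locally_lipschitz f"
  shows "AE x in lborel. \<exists>l. ((\<lambda>s. diff_quot f v s x) \<longlongrightarrow> l) (at 0)"
proof -
  have cf: "continuous_on UNIV f" by (rule locally_lipschitz_continuous_on[OF f])
  define E where "E r R = {x. (\<exists>\<^sub>F s in at 0. diff_quot f v s x < r) \<and> (\<exists>\<^sub>F s in at 0. diff_quot f v s x > R)}" for r R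
  have Em: "E r R \<in> sets borel" for r R
  proof -
    have "{x. \<exists>\<^sub>F s in at 0. diff_quot f v s x < r} \<inter> {x. \<exists>\<^sub>F s in at 0. diff_quot f v s x > R} \<in> sets borel"
      by (intro sets.Int frequently_at_0_sets_borel open_Collect_less continuous_on_diff_quot[OF cf] continuous_intros)
    then show ?thesis by (simp add: E_def Collect_conj_eq)
  qed
  have "AE x in lborel. x \<notin> E r R" if "r < R" for r R
  proof -
    have line: "z + t *\<^sub>R v \<notin> E r R" if "(\<lambda>t. f (z + t *\<^sub>R v)) differentiable (at t)" for z t
    proof
      assume E: "z + t *\<^sub>R v \<in> E r R"
      obtain D where "DERIV (\<lambda>t. f (z + t *\<^sub>R v)) t :> D"
        using \<open>_ differentiable _\<close> real_differentiable_def by blast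
      then have D: "((\<lambda>s. diff_quot f v s (z + t *\<^sub>R v)) \<longlongrightarrow> D) (at 0)"
        by (simp add: DERIV_def diff_quot_def scaleR_add_left add.assoc)
      have "\<not> (D < R)"
      proof
        assume "D < R"
        from order_tendstoD(2)[OF D this] have "\<forall>\<^sub>F s in at 0. \<not> diff_quot f v s (z + t *\<^sub>R v) > R"
          by eventually_elim simp
        then show False using E by (auto simp: E_def frequently_def)
      qed
      moreover have "\<not> (r < D)"
      proof
        assume "r < D"
        from order_tendstoD(1)[OF D this] have "\<forall>\<^sub>F s in at 0. \<not> diff_quot f v s (z + t *\<^sub>R v) < r"
          by eventually_elim simp
        then show False using E by (auto simp: E_def frequently_def)
      qed
      ultimately show False using \<open>r < R\<close> by simp
    qed
    have "AE z in lborel. AE t in lborel. z + t *\<^sub>R v \<notin> E r R"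
    proof (rule AE_I2)
      fix z
      show "AE t in lborel. z + t *\<^sub>R v \<notin> E r R"
        using locally_lipschitz_real_AE_differentiable[OF locally_lipschitz_line[OF f, of z v]]
        by eventually_elim (rule line)
    qed
    then show ?thesis using Em[of r R] by (subst (asm) AE_lines_iff) (auto simp: pred_def)
  qed
  then have "AE x in lborel. \<forall>r\<in>\<rat>. \<forall>R\<in>\<rat>. r < R \<longrightarrow> x \<notin> E r R"
    by (intro AE_ball_countable[THEN iffD2] ballI countable_rat) auto
  then show ?thesis
  proof eventually_elim
    case (elim x)
    obtain C where C: "0 \<le> C" "\<And>y s. norm y \<le> norm x \<Longrightarrow> \<bar>s\<bar> \<le> 1 \<Longrightarrow> \<bar>diff_quot f v s y\<bar> \<le> C"
      using diff_quot_bounded[OF f, where v=v] by blast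
    have ev: "\<forall>\<^sub>F s in at 0. \<bar>s\<bar> \<le> (1::real)"
      unfolding eventually_at by (intro exI[of _ 1]) (auto simp: dist_real_def)
    show ?case
    proof (rule tendsto_if_not_oscillating[where a="- C - 1" and b=C])
      show "\<forall>\<^sub>F s in at 0. - C - 1 < diff_quot f v s x"
        using ev by eventually_elim (use C(2)[of x] in \<open>force simp: abs_le_iff\<close>)
      show "\<forall>\<^sub>F s in at 0. diff_quot f v s x \<le> C"
        using ev by eventually_elim (use C(2)[of x] in \<open>force simp: abs_le_iff\<close>)
    qed (use elim in \<open>auto simp: E_def\<close>)
  qed
qed

text \<open>Below, compact support of a function is expressed by a radius \<open>R\<close> outside of which the
  function vanishes.\<close>

lemma continuous_compact_support_bounded:
  fixes g :: "'a::euclidean_space \<Rightarrow> real"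
  assumes g: "continuous_on UNIV g" and supp: "\<And>x. R < norm x \<Longrightarrow> g x = 0"
  obtains M where "0 \<le> M" "\<And>x. \<bar>g x\<bar> \<le> M"
proof -
  have "compact (g ` cball 0 R)"
    by (intro compact_continuous_image continuous_on_subset[OF g]) auto
  then obtain M where M: "\<And>x. x \<in> cball 0 R \<Longrightarrow> \<bar>g x\<bar> \<le> M"
    using compact_imp_bounded[of "g ` cball 0 R"] unfolding bounded_iff
    by (metis image_eqI real_norm_def)
  show thesis
  proof (rule that[of "max 0 M"])
    show "\<bar>g x\<bar> \<le> max 0 M" for x
      using M[of x] supp[of x] by (cases "norm x \<le> R") (auto simp: le_max_iff_disj)
  qed simp
qed

lemma continuous_compact_support_integrable:
  fixes g :: "'a::euclidean_space \<Rightarrow> real"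
  assumes g: "continuous_on UNIV g" and supp: "\<And>x. R < norm x \<Longrightarrow> g x = 0"
  shows "integrable lborel g"
proof -
  have "integrable lborel (\<lambda>x. indicator (cball 0 R) x *\<^sub>R g x)"
    by (intro borel_integrable_compact continuous_on_subset[OF g]) auto
  also have "(\<lambda>x. indicator (cball 0 R) x *\<^sub>R g x) = g"
    using supp by (auto simp: fun_eq_iff indicator_def)
  finally show ?thesis .
qed

lemma dominated_convergence_compact_support:
  fixes G :: "nat \<Rightarrow> 'a::euclidean_space \<Rightarrow> real"
  assumes [measurable]: "\<And>n. G n \<in> borel_measurable lborel" "H \<in> borel_measurable lborel"
    and lim: "AE x in lborel. (\<lambda>n. G n x) \<longlonglongrightarrow> H x"
    and bound: "\<And>n x. norm x \<le> R \<Longrightarrow> \<bar>G n x\<bar> \<le> C"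
    and supp: "\<And>n x. R < norm x \<Longrightarrow> G n x = 0"
  shows "(\<lambda>n. \<integral>x. G n x \<partial>lborel) \<longlonglongrightarrow> (\<integral>x. H x \<partial>lborel)" and "integrable lborel H"
proof -
  have int: "integrable lborel (\<lambda>x. C * indicator (cball (0::'a) R) x)"
    using emeasure_lborel_cball_finite[of "0::'a" R]
    by (intro integrable_mult_right integrable_real_indicator) auto
  have w: "AE x in lborel. norm (G n x) \<le> C * indicator (cball 0 R) x" for n
    using bound supp by (intro AE_I2) (auto simp: indicator_def not_le)
  show "(\<lambda>n. \<integral>x. G n x \<partial>lborel) \<longlonglongrightarrow> (\<integral>x. H x \<partial>lborel)" "integrable lborel H"
    by (rule integral_dominated_convergence[OF assms(2,1) int lim w]
        integrable_dominated_convergence[OF assms(2,1) int lim w])+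
qed

text \<open>The fundamental lemma of the calculus of variations for continuous test functions: the sign
  of \<open>W\<close> is almost everywhere a limit of continuous functions, so \<open>\<integral> \<bar>W\<bar> \<kappa> = 0\<close> for every
  cutoff function \<open>\<kappa>\<close>.\<close>

lemma AE_eq_0_if_integral_continuous_eq_0:
  fixes W :: "'a::euclidean_space \<Rightarrow> real"
  assumes W[measurable]: "W \<in> borel_measurable borel"
    and bounded: "\<And>R. \<exists>C. AE x in lborel. norm x \<le> R \<longrightarrow> \<bar>W x\<bar> \<le> C"
    and zero: "\<And>R \<eta>. continuous_on UNIV \<eta> \<Longrightarrow> (\<And>x. R < norm x \<Longrightarrow> \<eta> x = 0) \<Longrightarrow>
      (\<integral>x. W x * \<eta> x \<partial>lborel) = 0"
  shows "AE x in lborel. W x = 0"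
proof -
  have "(\<lambda>x. sgn (W x)) measurable_on UNIV"
    by (intro lebesgue_measurable_imp_measurable_on_real measurable_completion) auto
  then obtain N g where N: "negligible N" and g: "\<And>n. continuous_on UNIV (g n)"
      "\<And>x. x \<notin> N \<Longrightarrow> (\<lambda>n::nat. g n x) \<longlonglongrightarrow> sgn (W x)"
    by (auto simp: measurable_on_def)
  have AEN: "AE x in lborel. x \<notin> N"
  proof -
    have "AE x in lebesgue. x \<notin> N"
      using N by (intro AE_not_in) (simp add: negligible_iff_null_sets)
    then show ?thesis by (simp only: AE_completion_iff)
  qed
  have "AE x in lborel. norm x \<le> real m \<longrightarrow> W x = 0" for m :: nat
  proof -
    define \<kappa> where "\<kappa> x = max 0 (min 1 (real m + 1 - norm x))" for x :: 'a
    define \<eta> where "\<eta> n x = max (-1) (min 1 (g n x)) * \<kappa> x" for n x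
    obtain C where C: "AE x in lborel. norm x \<le> real m + 1 \<longrightarrow> \<bar>W x\<bar> \<le> C"
      using bounded by blast
    \<comment> \<open>\<open>W\<close> is bounded only almost everywhere; its truncation \<open>W'\<close> is bounded everywhere.\<close>
    define W' where "W' x = max (- C) (min C (W x))" for x
    have W'W: "AE x in lborel. norm x \<le> real m + 1 \<longrightarrow> W' x = W x"
      using C by eventually_elim (auto simp: W'_def)
    have [measurable]: "W' \<in> borel_measurable borel" unfolding W'_def by measurable
    have \<kappa>: "continuous_on UNIV \<kappa>" unfolding \<kappa>_def by (intro continuous_intros)
    have \<kappa>0: "\<kappa> x = 0" if "real m + 1 < norm x" for x using that by (simp add: \<kappa>_def)
    have \<kappa>b: "0 \<le> \<kappa> x" "\<kappa> x \<le> 1" for x by (auto simp: \<kappa>_def)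
    have \<eta>: "continuous_on UNIV (\<eta> n)" for n
      unfolding \<eta>_def by (intro continuous_intros g \<kappa>)
    have \<eta>0: "\<eta> n x = 0" if "real m + 1 < norm x" for n x using \<kappa>0[OF that] by (simp add: \<eta>_def)
    have [measurable]: "\<eta> n \<in> borel_measurable borel" "\<kappa> \<in> borel_measurable borel" for n
      using \<eta> \<kappa> by (auto intro: borel_measurable_continuous_onI)
    have 1: "(\<integral>x. W' x * \<eta> n x \<partial>lborel) = 0" for n
    proof -
      have "(\<integral>x. W' x * \<eta> n x \<partial>lborel) = (\<integral>x. W x * \<eta> n x \<partial>lborel)"
        using W'W by (intro integral_cong_AE; measurable?) (auto elim!: eventually_mono, metis \<eta>0 mult_zero_right not_le)
      then show ?thesis using zero[OF \<eta> \<eta>0] by simp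
    qed
    have lim: "AE x in lborel. (\<lambda>n. W' x * \<eta> n x) \<longlonglongrightarrow> W' x * (sgn (W x) * \<kappa> x)"
      using AEN
    proof eventually_elim
      case (elim x)
      have "(\<lambda>n. max (-1) (min 1 (g n x))) \<longlonglongrightarrow> max (-1) (min 1 (sgn (W x)))"
        using g(2)[OF elim] by (intro tendsto_intros)
      moreover have "max (-1) (min 1 (sgn (W x))) = sgn (W x)" by (auto simp: sgn_if)
      ultimately show ?case unfolding \<eta>_def by (intro tendsto_intros) simp
    qed
    have bnd: "\<bar>W' x * \<eta> n x\<bar> \<le> \<bar>C\<bar>" for n x
    proof -
      have "\<bar>W' x\<bar> \<le> \<bar>C\<bar>" by (auto simp: W'_def)
      moreover have "\<bar>\<eta> n x\<bar> \<le> 1 * 1"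
        unfolding \<eta>_def abs_mult using \<kappa>b[of x] by (intro mult_mono) auto
      ultimately have "\<bar>W' x\<bar> * \<bar>\<eta> n x\<bar> \<le> \<bar>C\<bar> * 1" by (intro mult_mono) auto
      then show ?thesis by (simp add: abs_mult)
    qed
    note dc = dominated_convergence_compact_support[of "\<lambda>n x. W' x * \<eta> n x"
        "\<lambda>x. W' x * (sgn (W x) * \<kappa> x)" "real m + 1" "\<bar>C\<bar>"]
    have "(\<lambda>n. 0) \<longlonglongrightarrow> (\<integral>x. W' x * (sgn (W x) * \<kappa> x) \<partial>lborel)"
      using dc(1) lim bnd \<eta>0 unfolding 1 by auto
    then have int0: "(\<integral>x. W' x * (sgn (W x) * \<kappa> x) \<partial>lborel) = 0"
      using LIMSEQ_unique tendsto_const by blast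
    have int: "integrable lborel (\<lambda>x. W' x * (sgn (W x) * \<kappa> x))"
      using dc(2) lim bnd \<eta>0 by auto
    have nn: "AE x in lborel. W' x * (sgn (W x) * \<kappa> x) = \<bar>W x\<bar> * \<kappa> x"
      using W'W
    proof eventually_elim
      case (elim x)
      then show ?case using \<kappa>0[of x]
        by (cases "norm x \<le> real m + 1") (auto simp: sgn_if)
    qed
    have "AE x in lborel. 0 \<le> W' x * (sgn (W x) * \<kappa> x)"
      using nn
    proof eventually_elim
      case (elim x)
      then show ?case using \<kappa>b(1)[of x] by (simp only: elim) simp
    qed
    then have "AE x in lborel. W' x * (sgn (W x) * \<kappa> x) = 0"
      using integral_nonneg_eq_0_iff_AE[OF int] int0 by simp
    then show ?thesis using nn
    proof eventually_elim
      case (elim x)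
      then have "\<bar>W x\<bar> * \<kappa> x = 0" by simp
      then show ?case by (auto simp: \<kappa>_def max_def min_def split: if_splits)
    qed
  qed
  then have "AE x in lborel. \<forall>m::nat. norm x \<le> real m \<longrightarrow> W x = 0"
    unfolding AE_all_countable by blast
  then show ?thesis
    by eventually_elim (meson real_arch_simple)
qed

text \<open>The derivative of \<open>f\<close> at \<open>x\<close> in the direction \<open>v\<close>. It is defined along the increments
  \<open>1 / (n + 1)\<close>, so that it is a Borel function of \<open>x\<close> for continuous \<open>f\<close> even if it does not
  exist at some points, where its value is of no significance.\<close>

definition dirder :: "('a::real_vector \<Rightarrow> real) \<Rightarrow> 'a \<Rightarrow> 'a \<Rightarrow> real" where
  "dirder f v x = lim (\<lambda>n. diff_quot f v (1 / real (Suc n)) x)"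

text \<open>The two-sided limit of the difference quotients exists; it is then \<open>dirder f v x\<close>.\<close>

definition has_dirder :: "('a::real_vector \<Rightarrow> real) \<Rightarrow> 'a \<Rightarrow> 'a \<Rightarrow> bool" where
  "has_dirder f v x \<longleftrightarrow> ((\<lambda>s. diff_quot f v s x) \<longlongrightarrow> dirder f v x) (at 0)"

lemma filterlim_inverse_Suc_at_0: "filterlim (\<lambda>n. 1 / real (Suc n)) (at 0) sequentially"
  unfolding filterlim_at
proof (intro conjI)
  show "(\<lambda>n. 1 / real (Suc n)) \<longlonglongrightarrow> 0"
    using LIMSEQ_inverse_real_of_nat by (simp add: inverse_eq_divide)
qed auto

lemma filterlim_neg_inverse_Suc_at_0: "filterlim (\<lambda>n. - (1 / real (Suc n))) (at 0) sequentially"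
  unfolding filterlim_at
proof (intro conjI)
  have "(\<lambda>n. 1 / real (Suc n)) \<longlonglongrightarrow> 0"
    using LIMSEQ_inverse_real_of_nat by (simp add: inverse_eq_divide)
  from tendsto_minus[OF this] show "(\<lambda>n. - (1 / real (Suc n))) \<longlonglongrightarrow> 0" by simp
qed auto

lemma dirder_eqI:
  assumes "((\<lambda>s. diff_quot f v s x) \<longlongrightarrow> l) (at 0)"
  shows "dirder f v x = l"
  unfolding dirder_def
  using filterlim_compose[OF assms filterlim_inverse_Suc_at_0] by (rule limI)

lemma has_dirder_seq:
  assumes "has_dirder f v x"
  shows "(\<lambda>n. diff_quot f v (1 / real (Suc n)) x) \<longlonglongrightarrow> dirder f v x"
    and "(\<lambda>n. diff_quot f v (- (1 / real (Suc n))) x) \<longlonglongrightarrow> dirder f v x"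
  using assms filterlim_compose[OF _ filterlim_inverse_Suc_at_0]
    filterlim_compose[OF _ filterlim_neg_inverse_Suc_at_0]
  unfolding has_dirder_def by blast+

lemma AE_has_dirder:
  fixes f :: "'a::euclidean_space \<Rightarrow> real"
  assumes f: "locally_lipschitz f"
  shows "AE x in lborel. has_dirder f v x"
  using AE_directional_derivative_exists[OF f, of v]
  by eventually_elim (auto simp: has_dirder_def dest: dirder_eqI)

lemma dirder_measurable:
  fixes f :: "'a::euclidean_space \<Rightarrow> real"
  assumes "locally_lipschitz f"
  shows "dirder f v \<in> borel_measurable borel"
  unfolding dirder_def
  by (intro borel_measurable_lim_metric diff_quot_measurable locally_lipschitz_continuous_on assms)

lemma dirder_bounded:
  fixes f :: "'a::euclidean_space \<Rightarrow> real"
  assumes f: "locally_lipschitz f"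
  shows "\<exists>C. AE x in lborel. norm x \<le> R \<longrightarrow> \<bar>dirder f v x\<bar> \<le> C"
proof -
  obtain C where C: "0 \<le> C" "\<And>x s. norm x \<le> R \<Longrightarrow> \<bar>s\<bar> \<le> 1 \<Longrightarrow> \<bar>diff_quot f v s x\<bar> \<le> C"
    using diff_quot_bounded[OF f, where R=R and v=v] by blast
  have "AE x in lborel. norm x \<le> R \<longrightarrow> \<bar>dirder f v x\<bar> \<le> C"
    using AE_has_dirder[OF f, of v]
  proof eventually_elim
    case (elim x)
    show ?case
    proof
      assume x: "norm x \<le> R"
      have "(\<lambda>n. \<bar>diff_quot f v (1 / real (Suc n)) x\<bar>) \<longlonglongrightarrow> \<bar>dirder f v x\<bar>"
        using has_dirder_seq(1)[OF elim] by (rule tendsto_rabs)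
      then show "\<bar>dirder f v x\<bar> \<le> C"
        by (rule LIMSEQ_le_const2) (auto intro!: C x exI[of _ 0])
    qed
  qed
  then show ?thesis by blast
qed

lemma dirder_scale:
  assumes "has_dirder f v x"
  shows "dirder f (c *\<^sub>R v) x = c * dirder f v x"
proof (rule dirder_eqI, cases "c = 0")
  case True
  then show "((\<lambda>s. diff_quot f (c *\<^sub>R v) s x) \<longlongrightarrow> c * dirder f v x) (at 0)"
    by (simp add: diff_quot_def)
next
  case False
  have "filterlim (\<lambda>s. s * c) (at 0) (at (0::real))"
    using False unfolding filterlim_at
    by (auto intro!: tendsto_eq_intros simp: eventually_at_filter)
  then have "((\<lambda>s. c * diff_quot f v (s * c) x) \<longlongrightarrow> c * dirder f v x) (at 0)"
    using assms unfolding has_dirder_def by (intro tendsto_intros) (rule filterlim_compose)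
  also have "(\<lambda>s. c * diff_quot f v (s * c) x) = (\<lambda>s. diff_quot f (c *\<^sub>R v) s x)"
    using False by (auto simp: diff_quot_def fun_eq_iff)
  finally show "((\<lambda>s. diff_quot f (c *\<^sub>R v) s x) \<longlongrightarrow> c * dirder f v x) (at 0)" .
qed

lemma diff_quot_add:
  "diff_quot f (u + v) s x = diff_quot f u s x + diff_quot f v s (x + s *\<^sub>R u)"
  by (simp add: diff_quot_def scaleR_add_right add.assoc diff_divide_distrib)

text \<open>By \<open>diff_quot_add\<close>, the difference of the quotients on both sides is
  \<open>diff_quot f v s (x + s u) - diff_quot f v s x\<close>. Integration against a continuous compactly
  supported \<open>\<eta>\<close> and a translation by \<open>s u\<close> move the shift to \<open>\<eta>\<close>, where it disappears in the
  limit.\<close>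

lemma AE_dirder_add:
  fixes f :: "'a::euclidean_space \<Rightarrow> real"
  assumes f: "locally_lipschitz f"
  shows "AE x in lborel. dirder f (u + v) x = dirder f u x + dirder f v x"
proof -
  define W where "W x = dirder f (u + v) x - dirder f u x - dirder f v x" for x
  have cf: "continuous_on UNIV f" by (rule locally_lipschitz_continuous_on[OF f])
  note cq = continuous_on_diff_quot[OF cf]
  note [measurable] = diff_quot_measurable[OF cf]
  have [measurable]: "W \<in> borel_measurable borel" unfolding W_def
    by (intro borel_measurable_diff dirder_measurable f)
  have "AE x in lborel. W x = 0"
  proof (rule AE_eq_0_if_integral_continuous_eq_0)
    fix R
    obtain C1 where C1: "AE x in lborel. norm x \<le> R \<longrightarrow> \<bar>dirder f (u + v) x\<bar> \<le> C1"
      using dirder_bounded[OF f, of R "u + v"] by blast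
    obtain C2 where C2: "AE x in lborel. norm x \<le> R \<longrightarrow> \<bar>dirder f u x\<bar> \<le> C2"
      using dirder_bounded[OF f, of R u] by blast
    obtain C3 where C3: "AE x in lborel. norm x \<le> R \<longrightarrow> \<bar>dirder f v x\<bar> \<le> C3"
      using dirder_bounded[OF f, of R v] by blast
    from C1 C2 C3 have "AE x in lborel. norm x \<le> R \<longrightarrow> \<bar>W x\<bar> \<le> C1 + C2 + C3"
      by eventually_elim (auto simp: W_def)
    then show "\<exists>C. AE x in lborel. norm x \<le> R \<longrightarrow> \<bar>W x\<bar> \<le> C" by blast
  next
    fix R and \<eta> :: "'a \<Rightarrow> real"
    assume \<eta>: "continuous_on UNIV \<eta>" and \<eta>0: "\<And>x. R < norm x \<Longrightarrow> \<eta> x = 0"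
    note [measurable] = borel_measurable_continuous_onI[OF \<eta>]
    define s where "s n = 1 / real (Suc n)" for n
    have s: "0 < s n" "\<bar>s n\<bar> \<le> 1" for n by (auto simp: s_def)
    have s0: "s \<longlonglongrightarrow> 0" unfolding s_def
      using LIMSEQ_inverse_real_of_nat by (simp add: inverse_eq_divide)
    \<comment> \<open>\<open>A\<close> and \<open>B\<close> are the integrands before and after the translation.\<close>
    define A where "A n x = (diff_quot f (u + v) (s n) x - diff_quot f u (s n) x
      - diff_quot f v (s n) x) * \<eta> x" for n x
    define B where "B n x = diff_quot f v (s n) x * (\<eta> (x - s n *\<^sub>R u) - \<eta> x)" for n x
    obtain M where M: "0 \<le> M" "\<And>x. \<bar>\<eta> x\<bar> \<le> M"
      using continuous_compact_support_bounded[OF \<eta> \<eta>0] by metis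
    define R' where "R' = R + norm u"
    have shift: "R < norm (x - s n *\<^sub>R u)" if "R' < norm x" for n x
    proof -
      have "norm x \<le> norm (x - s n *\<^sub>R u) + norm (s n *\<^sub>R u)"
        using norm_triangle_ineq[of "x - s n *\<^sub>R u" "s n *\<^sub>R u"] by simp
      moreover have "norm (s n *\<^sub>R u) \<le> norm u"
        using s(2)[of n] by (simp add: mult_left_le_one_le)
      ultimately show ?thesis using that by (simp add: R'_def)
    qed
    have RR': "R \<le> R'" by (simp add: R'_def)
    have AB: "(\<integral>x. A n x \<partial>lborel) = (\<integral>x. B n x \<partial>lborel)" for n
    proof -
      have c1: "continuous_on UNIV (\<lambda>x. \<eta> (x - s n *\<^sub>R u))"
        by (intro continuous_intros continuous_on_compose2[OF \<eta>]) auto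
      have c2: "continuous_on UNIV (\<lambda>x. diff_quot f v (s n) (x + s n *\<^sub>R u))"
        by (intro continuous_intros continuous_on_compose2[OF cq]) auto
      define g where "g x = diff_quot f v (s n) x * \<eta> (x - s n *\<^sub>R u)" for x
      have gc: "continuous_on UNIV g" unfolding g_def by (intro continuous_intros cq c1)
      have i1: "integrable lborel (\<lambda>x. diff_quot f v (s n) x * \<eta> x)"
        by (rule continuous_compact_support_integrable[where R=R])
          (auto intro!: continuous_intros cq \<eta> \<eta>0)
      have g0: "g x = 0" if "R' < norm x" for x using shift[OF that] by (simp add: g_def \<eta>0)
      have i2: "integrable lborel g"
        by (rule continuous_compact_support_integrable[OF gc g0])
      have i3: "integrable lborel (\<lambda>x. diff_quot f v (s n) (x + s n *\<^sub>R u) * \<eta> x)"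
        by (rule continuous_compact_support_integrable[where R=R])
          (auto intro!: continuous_intros c2 \<eta> \<eta>0)
      have "A n x = diff_quot f v (s n) (x + s n *\<^sub>R u) * \<eta> x - diff_quot f v (s n) x * \<eta> x" for x
        by (simp add: A_def diff_quot_add algebra_simps)
      then have "(\<integral>x. A n x \<partial>lborel) =
          (\<integral>x. g (x + s n *\<^sub>R u) \<partial>lborel) - (\<integral>x. diff_quot f v (s n) x * \<eta> x \<partial>lborel)"
        using i1 i3 by (simp add: g_def)
      also have "(\<integral>x. g (x + s n *\<^sub>R u) \<partial>lborel) = (\<integral>x. g x \<partial>lborel)"
        by (intro integral_lborel_translation borel_measurable_continuous_onI gc)
      also have "(\<integral>x. g x \<partial>lborel) - (\<integral>x. diff_quot f v (s n) x * \<eta> x \<partial>lborel) = (\<integral>x. B n x \<partial>lborel)"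
      proof -
        have "B n x = g x - diff_quot f v (s n) x * \<eta> x" for x
          by (simp add: B_def g_def right_diff_distrib)
        then show ?thesis using i1 i2 by simp
      qed
      finally show ?thesis .
    qed
    obtain C where C: "0 \<le> C" "\<And>x s. norm x \<le> R' \<Longrightarrow> \<bar>s\<bar> \<le> 1 \<Longrightarrow> \<bar>diff_quot f v s x\<bar> \<le> C"
      using diff_quot_bounded[OF f, where R=R' and v=v] by blast
    obtain C1 where C1: "0 \<le> C1" "\<And>x s. norm x \<le> R' \<Longrightarrow> \<bar>s\<bar> \<le> 1 \<Longrightarrow> \<bar>diff_quot f u s x\<bar> \<le> C1"
      using diff_quot_bounded[OF f, where R=R' and v=u] by blast
    obtain C2 where C2: "0 \<le> C2" "\<And>x s. norm x \<le> R' \<Longrightarrow> \<bar>s\<bar> \<le> 1 \<Longrightarrow> \<bar>diff_quot f (u + v) s x\<bar> \<le> C2"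
      using diff_quot_bounded[OF f, where R=R' and v="u + v"] by blast
    have limA: "(\<lambda>n. \<integral>x. A n x \<partial>lborel) \<longlonglongrightarrow> (\<integral>x. W x * \<eta> x \<partial>lborel)"
    proof (rule dominated_convergence_compact_support(1)[where R=R and C="(C2 + C1 + C) * M"])
      show "AE x in lborel. (\<lambda>n. A n x) \<longlonglongrightarrow> W x * \<eta> x"
        using AE_has_dirder[OF f, of "u + v"] AE_has_dirder[OF f, of u] AE_has_dirder[OF f, of v]
      proof eventually_elim
        case (elim x)
        have d: "(\<lambda>n. diff_quot f v' (s n) x) \<longlonglongrightarrow> dirder f v' x" if "has_dirder f v' x" for v'
          using has_dirder_seq(1)[OF that] by (simp add: s_def)
        show ?case unfolding A_def W_def
          by (rule tendsto_mult[OF tendsto_diff[OF tendsto_diff[OF d[OF elim(1)] d[OF elim(2)]] d[OF elim(3)]]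
              tendsto_const])
      qed
      fix n and x :: 'a assume x: "norm x \<le> R"
      have "\<bar>diff_quot f (u + v) (s n) x - diff_quot f u (s n) x - diff_quot f v (s n) x\<bar> \<le> C2 + C1 + C"
        using C(2)[of x "s n"] C1(2)[of x "s n"] C2(2)[of x "s n"] x RR' s(2)[of n] by linarith
      then show "\<bar>A n x\<bar> \<le> (C2 + C1 + C) * M"
        unfolding A_def abs_mult using M by (intro mult_mono) auto
    qed (auto simp: A_def \<eta>0)
    have limB: "(\<lambda>n. \<integral>x. B n x \<partial>lborel) \<longlonglongrightarrow> (\<integral>x. 0 \<partial>(lborel :: 'a measure))"
    proof (rule dominated_convergence_compact_support(1)[where R=R' and C="C * (M + M)"])
      show "AE x in lborel. (\<lambda>n. B n x) \<longlonglongrightarrow> 0"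
        using AE_has_dirder[OF f, of v]
      proof eventually_elim
        case (elim x)
        have "(\<lambda>n. x - s n *\<^sub>R u) \<longlonglongrightarrow> x - 0 *\<^sub>R u" by (intro tendsto_intros s0)
        then have lim: "(\<lambda>n. x - s n *\<^sub>R u) \<longlonglongrightarrow> x" by simp
        have "isCont \<eta> x" using \<eta> by (simp add: continuous_on_eq_continuous_at)
        from isCont_tendsto_compose[OF this lim]
        have "(\<lambda>n. \<eta> (x - s n *\<^sub>R u)) \<longlonglongrightarrow> \<eta> x" .
        moreover have "(\<lambda>n. diff_quot f v (s n) x) \<longlonglongrightarrow> dirder f v x"
          using has_dirder_seq(1)[OF elim] by (simp add: s_def)
        ultimately have "(\<lambda>n. B n x) \<longlonglongrightarrow> dirder f v x * (\<eta> x - \<eta> x)"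
          unfolding B_def by (intro tendsto_mult tendsto_diff tendsto_const)
        then show ?case by simp
      qed
      fix n and x :: 'a assume x: "norm x \<le> R'"
      have "\<bar>\<eta> (x - s n *\<^sub>R u) - \<eta> x\<bar> \<le> M + M"
        using M(2)[of "x - s n *\<^sub>R u"] M(2)[of x] by linarith
      then show "\<bar>B n x\<bar> \<le> C * (M + M)"
        unfolding B_def abs_mult using C x s by (intro mult_mono) auto
    qed (use shift RR' in \<open>auto simp: B_def \<eta>0\<close>)
    show "(\<integral>x. W x * \<eta> x \<partial>lborel) = 0"
      using LIMSEQ_unique[OF limA limB[folded AB]] by simp
  qed auto
  then show ?thesis by eventually_elim (simp add: W_def)
qed

section \<open>Rademacher's theorem\<close>

text \<open>The vector of partial derivatives. In contrast to \<open>grad\<close> it does not presuppose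
  differentiability.\<close>

definition dirder_grad :: "('a::euclidean_space \<Rightarrow> real) \<Rightarrow> 'a \<Rightarrow> 'a" where
  "dirder_grad f x = (\<Sum>b\<in>Basis. dirder f b x *\<^sub>R b)"

text \<open>The exceptional null set depends on the direction \<open>v\<close>.\<close>

lemma AE_dirder_eq_inner:
  fixes f :: "'a::euclidean_space \<Rightarrow> real"
  assumes f: "locally_lipschitz f"
  shows "AE x in lborel. dirder f v x = v \<bullet> dirder_grad f x"
proof -
  have "finite A \<Longrightarrow> A \<subseteq> Basis \<Longrightarrow>
      AE x in lborel. dirder f (\<Sum>b\<in>A. (v \<bullet> b) *\<^sub>R b) x = (\<Sum>b\<in>A. (v \<bullet> b) * dirder f b x)" for A
  proof (induction rule: finite_induct)
    case empty
    have "dirder f 0 x = 0" for x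
      by (rule dirder_eqI) (simp add: diff_quot_def)
    then show ?case by simp
  next
    case (insert b A)
    have "AE x in lborel. dirder f (\<Sum>b\<in>A. (v \<bullet> b) *\<^sub>R b) x = (\<Sum>b\<in>A. (v \<bullet> b) * dirder f b x)"
      using insert by simp
    moreover have "AE x in lborel. dirder f ((v \<bullet> b) *\<^sub>R b + (\<Sum>b\<in>A. (v \<bullet> b) *\<^sub>R b)) x =
        dirder f ((v \<bullet> b) *\<^sub>R b) x + dirder f (\<Sum>b\<in>A. (v \<bullet> b) *\<^sub>R b) x"
      by (rule AE_dirder_add[OF f])
    ultimately show ?case using AE_has_dirder[OF f, of b]
      by eventually_elim (use insert in \<open>simp add: dirder_scale\<close>)
  qed
  from this[of Basis] show ?thesis
    by (simp add: euclidean_representation dirder_grad_def inner_sum_right mult.commute)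
qed

theorem rademacher:
  fixes f :: "'a::euclidean_space \<Rightarrow> real"
  assumes f: "locally_lipschitz f"
  shows "AE x in lborel. f differentiable (at x)"
proof -
  obtain D :: "'a set" where D: "countable D" "\<And>X. open X \<Longrightarrow> X \<noteq> {} \<Longrightarrow> \<exists>d\<in>D. d \<in> X"
    by (rule countable_dense_setE) blast
  have "AE x in lborel. \<forall>v\<in>D. has_dirder f v x \<and> dirder f v x = v \<bullet> dirder_grad f x"
    unfolding AE_ball_countable[OF D(1)]
    using AE_has_dirder[OF f] AE_dirder_eq_inner[OF f] by auto
  then show ?thesis
  proof eventually_elim
    case (elim x)
    define G where "G = dirder_grad f x"
    have lim: "((\<lambda>s. diff_quot f v s x) \<longlongrightarrow> v \<bullet> G) (at 0)" if "v \<in> D" for v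
      using bspec[OF elim that] unfolding has_dirder_def G_def by metis
    obtain u L where u: "u > 0" and L: "L-lipschitz_on (cball x u) f"
      using f unfolding locally_lipschitz_def by blast
    have L0: "0 \<le> L" using L by (rule lipschitz_on_nonneg)
    have "(f has_derivative (\<lambda>h. h \<bullet> G)) (at x)"
      unfolding has_derivative_at_alt
    proof (intro conjI allI impI)
      show "bounded_linear (\<lambda>h. h \<bullet> G)" by (rule bounded_linear_inner_left)
      fix \<epsilon> :: real assume \<epsilon>: "0 < \<epsilon>"
      define e where "e = min 1 (\<epsilon> / (L + 1 + norm G))"
      have den: "0 < L + 1 + norm G" using L0 by (simp add: add_nonneg_pos add_pos_nonneg)
      have e: "0 < e" "e \<le> 1" using \<epsilon> den by (auto simp: e_def)
      have "e * (L + 1 + norm G) \<le> \<epsilon> / (L + 1 + norm G) * (L + 1 + norm G)"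
        using den by (intro mult_right_mono) (auto simp: e_def)
      then have eb: "e * (L + 1 + norm G) \<le> \<epsilon>" using den by simp
      \<comment> \<open>Finitely many directions of \<open>D\<close> are \<open>e\<close>-close to all unit vectors, so the difference
        quotients in these directions converge uniformly. For another direction \<open>\<theta>\<close> the
        replacement by a close \<open>v\<close> costs at most \<open>L e\<close> in \<open>f\<close> and \<open>e \<bar>G\<bar>\<close> in the linear part,
        per unit length of the increment.\<close>
      have cover: "cball 0 1 \<subseteq> (\<Union>v\<in>D. ball v e)"
      proof
        fix y :: 'a
        obtain d where "d \<in> D" "d \<in> ball y e" using D(2)[of "ball y e"] e by auto
        then show "y \<in> (\<Union>v\<in>D. ball v e)" by (auto simp: dist_commute)
      qed
      obtain D' where D': "D' \<subseteq> D" "finite D'" "cball 0 1 \<subseteq> (\<Union>v\<in>D'. ball v e)"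
        using compactE_image[OF compact_cball _ cover] by blast
      have "\<forall>\<^sub>F s in at 0. \<forall>v\<in>D'. dist (diff_quot f v s x) (v \<bullet> G) < e"
        using D' lim e by (intro eventually_ball_finite ballI tendstoD) auto
      then obtain d where d: "d > 0"
        "\<And>s v. s \<noteq> 0 \<Longrightarrow> \<bar>s\<bar> < d \<Longrightarrow> v \<in> D' \<Longrightarrow> dist (diff_quot f v s x) (v \<bullet> G) < e"
        unfolding eventually_at by (auto simp: dist_real_def)
      show "\<exists>d>0. \<forall>y. norm (y - x) < d \<longrightarrow> norm (f y - f x - (y - x) \<bullet> G) \<le> \<epsilon> * norm (y - x)"
      proof (intro exI[of _ "min d (u / 2)"] conjI allI impI)
        show "0 < min d (u / 2)" using d u by simp
        fix y assume y: "norm (y - x) < min d (u / 2)"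
        show "norm (f y - f x - (y - x) \<bullet> G) \<le> \<epsilon> * norm (y - x)"
        proof (cases "y = x")
          case False
          define r where "r = norm (y - x)"
          define \<theta> where "\<theta> = (1 / r) *\<^sub>R (y - x)"
          have r: "r > 0" using False by (simp add: r_def)
          have y_eq: "y = x + r *\<^sub>R \<theta>" using r by (simp add: \<theta>_def)
          have "norm \<theta> = 1" using r by (simp add: \<theta>_def r_def)
          then have "\<theta> \<in> cball 0 1" by simp
          then obtain v where v: "v \<in> D'" "dist v \<theta> < e" using D'(3) by auto
          have nv: "norm v \<le> 2"
            using norm_triangle_sub[of v \<theta>] v(2) e \<open>norm \<theta> = 1\<close> by (simp add: dist_norm)
          have "dist x (x + r *\<^sub>R v) \<le> u"
          proof -
            have "r * norm v \<le> r * 2" using r nv by (intro mult_left_mono) auto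
            also have "r * 2 \<le> u" using y by (simp add: r_def)
            finally show ?thesis using r by (simp add: dist_norm)
          qed
          moreover have "dist x y \<le> u" using y u by (simp add: dist_norm norm_minus_commute)
          ultimately have "\<bar>f y - f (x + r *\<^sub>R v)\<bar> \<le> L * dist y (x + r *\<^sub>R v)"
            using lipschitz_onD[OF L, of y "x + r *\<^sub>R v"] by (simp add: dist_real_def)
          also have "dist y (x + r *\<^sub>R v) = r * dist v \<theta>"
          proof -
            have "y - (x + r *\<^sub>R v) = r *\<^sub>R (\<theta> - v)" by (simp add: y_eq scaleR_diff_right)
            then show ?thesis using r by (simp add: dist_norm norm_minus_commute)
          qed
          also have "L * (r * dist v \<theta>) \<le> L * (r * e)"
            using L0 r v by (intro mult_left_mono) auto
          finally have 1: "\<bar>f y - f (x + r *\<^sub>R v)\<bar> \<le> L * (r * e)" .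
          have "\<bar>diff_quot f v r x - v \<bullet> G\<bar> < e"
            using d(2)[of r v] r y v by (simp add: dist_real_def r_def)
          then have "r * \<bar>diff_quot f v r x - v \<bullet> G\<bar> \<le> r * e" using r by simp
          also have "r * \<bar>diff_quot f v r x - v \<bullet> G\<bar> = \<bar>f (x + r *\<^sub>R v) - f x - r * (v \<bullet> G)\<bar>"
          proof -
            have "r * \<bar>diff_quot f v r x - v \<bullet> G\<bar> = \<bar>r * (diff_quot f v r x - v \<bullet> G)\<bar>"
              using r by (simp add: abs_mult)
            also have "r * (diff_quot f v r x - v \<bullet> G) = f (x + r *\<^sub>R v) - f x - r * (v \<bullet> G)"
              using r by (simp add: diff_quot_def field_simps)
            finally show ?thesis .
          qed
          finally have 2: "\<bar>f (x + r *\<^sub>R v) - f x - r * (v \<bullet> G)\<bar> \<le> r * e" .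
          have "\<bar>(v - \<theta>) \<bullet> G\<bar> \<le> norm (v - \<theta>) * norm G" by (rule Cauchy_Schwarz_ineq2)
          also have "\<dots> \<le> e * norm G" using v by (intro mult_right_mono) (auto simp: dist_norm)
          finally have "r * \<bar>(v - \<theta>) \<bullet> G\<bar> \<le> r * (e * norm G)" using r by simp
          moreover have "r * \<bar>(v - \<theta>) \<bullet> G\<bar> = \<bar>r * (v \<bullet> G) - (y - x) \<bullet> G\<bar>"
          proof -
            have "r * \<bar>(v - \<theta>) \<bullet> G\<bar> = \<bar>r * ((v - \<theta>) \<bullet> G)\<bar>" using r by (simp add: abs_mult)
            also have "r * ((v - \<theta>) \<bullet> G) = r * (v \<bullet> G) - (y - x) \<bullet> G"
              by (simp add: y_eq inner_diff_left right_diff_distrib)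
            finally show ?thesis .
          qed
          ultimately have 3: "\<bar>r * (v \<bullet> G) - (y - x) \<bullet> G\<bar> \<le> r * (e * norm G)" by simp
          have "\<bar>f y - f x - (y - x) \<bullet> G\<bar> \<le> L * (r * e) + r * e + r * (e * norm G)"
            using 1 2 3 by linarith
          also have "\<dots> = e * (L + 1 + norm G) * r" by (simp add: algebra_simps)
          also have "\<dots> \<le> \<epsilon> * r" using eb r by (intro mult_right_mono) auto
          finally show ?thesis by (simp add: r_def)
        qed simp
      qed
    qed
    then show ?case by (auto simp: differentiable_def)
  qed
qed

lemma has_derivative_grad:
  fixes f :: "'a::euclidean_space \<Rightarrow> real"
  assumes "f differentiable (at x)"
  shows "(f has_derivative (\<lambda>h. h \<bullet> grad f x)) (at x)"
proof -
  obtain f' where f': "(f has_derivative f') (at x)"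
    using assms by (auto simp: differentiable_def)
  interpret linear f' using f' by (rule has_derivative_linear)
  define D where "D = (\<Sum>b\<in>Basis. f' b *\<^sub>R b)"
  have "f' h = h \<bullet> D" for h
  proof -
    have "f' h = f' (\<Sum>b\<in>Basis. (h \<bullet> b) *\<^sub>R b)" by (simp add: euclidean_representation)
    also have "\<dots> = h \<bullet> D" by (simp add: sum scale D_def inner_sum_right mult.commute)
    finally show ?thesis .
  qed
  then have "f' = (\<lambda>h. h \<bullet> D)" by (rule ext)
  then have D: "GDERIV f x :> D" using f' by (simp add: gderiv_def)
  moreover have "D' = D" if "GDERIV f x :> D'" for D'
  proof -
    have "(\<lambda>h. h \<bullet> D') = (\<lambda>h. h \<bullet> D)"
      using that D unfolding gderiv_def by (rule has_derivative_unique)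
    then show ?thesis by (simp add: fun_eq_iff) (metis vector_eq_ldot)
  qed
  ultimately have "(THE D. GDERIV f x :> D) = D" by (rule the_equality)
  then have "grad f x = D" using assms by (simp add: grad_def)
  then show ?thesis using D by (simp add: gderiv_def)
qed

lemma differentiable_imp_has_dirder:
  fixes f :: "'a::euclidean_space \<Rightarrow> real"
  assumes f: "f differentiable (at x)"
  shows "has_dirder f v x" and "dirder f v x = v \<bullet> grad f x"
    and "dirder f v x = frechet_derivative f (at x) v"
proof -
  have D: "(f has_derivative (\<lambda>h. h \<bullet> grad f x)) (at x)" by (rule has_derivative_grad[OF f])
  have "((\<lambda>s. f (x + s *\<^sub>R v)) has_derivative (\<lambda>s. (s *\<^sub>R v) \<bullet> grad f x)) (at 0)"
    by (rule has_derivative_compose[where g=f]) (use D in \<open>auto intro!: derivative_eq_intros\<close>)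
  then have "DERIV (\<lambda>s. f (x + s *\<^sub>R v)) 0 :> v \<bullet> grad f x"
    by (simp add: has_field_derivative_def mult_commute_abs)
  then have "((\<lambda>s. diff_quot f v s x) \<longlongrightarrow> v \<bullet> grad f x) (at 0)"
    by (simp add: DERIV_def diff_quot_def)
  from dirder_eqI[OF this] this show "has_dirder f v x" "dirder f v x = v \<bullet> grad f x"
    by (auto simp: has_dirder_def)
  then show "dirder f v x = frechet_derivative f (at x) v"
    using frechet_derivative_at[OF D] by metis
qed

section \<open>Integration by parts and test functions\<close>

text \<open>The derivatives may fail to exist on null sets. The integral of \<open>diff_quot f v s x * \<eta> x\<close> equals,
  after a translation of the first term by \<open>s v\<close>, minus the integral of
  \<open>f x * diff_quot \<eta> v (- s) x\<close>. Both sides converge by dominated convergence.\<close>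

lemma dirder_integration_by_parts:
  fixes f \<eta> :: "'a::euclidean_space \<Rightarrow> real"
  assumes f: "locally_lipschitz f" and \<eta>: "locally_lipschitz \<eta>"
    and \<eta>0: "\<And>x. R < norm x \<Longrightarrow> \<eta> x = 0"
  shows "(\<integral>x. dirder f v x * \<eta> x \<partial>lborel) = - (\<integral>x. f x * dirder \<eta> v x \<partial>lborel)"
proof -
  have cf: "continuous_on UNIV f" and c\<eta>: "continuous_on UNIV \<eta>"
    using f \<eta> by (auto intro: locally_lipschitz_continuous_on)
  have fm: "f \<in> borel_measurable borel" and \<eta>m: "\<eta> \<in> borel_measurable borel"
    using cf c\<eta> by (auto intro: borel_measurable_continuous_onI)
  define s where "s n = 1 / real (Suc n)" for n
  have s: "0 < s n" "\<bar>s n\<bar> \<le> 1" for n by (auto simp: s_def)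
  define A where "A n x = diff_quot f v (s n) x * \<eta> x" for n x
  define B where "B n x = f x * diff_quot \<eta> v (- s n) x" for n x
  have cA: "continuous_on UNIV (A n)" and cB: "continuous_on UNIV (B n)" for n
    unfolding A_def B_def by (intro continuous_intros cf c\<eta> continuous_on_diff_quot)+
  define R' where "R' = R + norm v"
  have shift: "R < norm (x - s n *\<^sub>R v)" if "R' < norm x" for n x
  proof -
    have "norm x \<le> norm (x - s n *\<^sub>R v) + norm (s n *\<^sub>R v)"
      using norm_triangle_ineq[of "x - s n *\<^sub>R v" "s n *\<^sub>R v"] by simp
    moreover have "norm (s n *\<^sub>R v) \<le> norm v"
      using s(2)[of n] by (simp add: mult_left_le_one_le)
    ultimately show ?thesis using that by (simp add: R'_def)
  qed
  have RR': "R \<le> R'" by (simp add: R'_def)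
  have AB: "(\<integral>x. A n x \<partial>lborel) = - (\<integral>x. B n x \<partial>lborel)" for n
  proof -
    have c1: "continuous_on UNIV (\<lambda>x. \<eta> (x - s n *\<^sub>R v))"
      by (intro continuous_intros continuous_on_compose2[OF c\<eta>]) auto
    have c2: "continuous_on UNIV (\<lambda>x. f (x + s n *\<^sub>R v))"
      by (intro continuous_intros continuous_on_compose2[OF cf]) auto
    define g where "g x = f x * \<eta> (x - s n *\<^sub>R v)" for x
    define k where "k x = f x * \<eta> x" for x
    have gc: "continuous_on UNIV g" and kc: "continuous_on UNIV k"
      unfolding g_def k_def by (intro continuous_intros cf c1 c\<eta>)+
    have g0: "g x = 0" if "R' < norm x" for x using shift[OF that] by (simp add: g_def \<eta>0)
    have k0: "k x = 0" if "R < norm x" for x using that by (simp add: k_def \<eta>0)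
    have gi: "integrable lborel g" by (rule continuous_compact_support_integrable[OF gc g0])
    have ki: "integrable lborel k" by (rule continuous_compact_support_integrable[OF kc k0])
    have gti: "integrable lborel (\<lambda>x. g (x + s n *\<^sub>R v))"
    proof (rule continuous_compact_support_integrable[where R=R])
      show "continuous_on UNIV (\<lambda>x. g (x + s n *\<^sub>R v))"
        by (intro continuous_intros continuous_on_compose2[OF gc]) auto
    qed (simp add: g_def \<eta>0)
    have "A n x = (g (x + s n *\<^sub>R v) - k x) / s n" for x
      by (simp add: A_def g_def k_def diff_quot_def algebra_simps diff_divide_distrib)
    then have "(\<integral>x. A n x \<partial>lborel) =
        ((\<integral>x. g (x + s n *\<^sub>R v) \<partial>lborel) - (\<integral>x. k x \<partial>lborel)) / s n"
      using gti ki by simp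
    also have "(\<integral>x. g (x + s n *\<^sub>R v) \<partial>lborel) = (\<integral>x. g x \<partial>lborel)"
      by (intro integral_lborel_translation borel_measurable_continuous_onI gc)
    also have "((\<integral>x. g x \<partial>lborel) - (\<integral>x. k x \<partial>lborel)) / s n = (\<integral>x. - B n x \<partial>lborel)"
    proof -
      have "- B n x = (g x - k x) / s n" for x
        by (simp add: B_def g_def k_def diff_quot_def algebra_simps diff_divide_distrib)
      then show ?thesis using gi ki by simp
    qed
    finally show ?thesis by simp
  qed
  obtain C where C: "0 \<le> C" "\<And>x s. norm x \<le> R \<Longrightarrow> \<bar>s\<bar> \<le> 1 \<Longrightarrow> \<bar>diff_quot f v s x\<bar> \<le> C"
    using diff_quot_bounded[OF f, where R=R and v=v] by blast
  obtain C' where C': "0 \<le> C'" "\<And>x s. norm x \<le> R' \<Longrightarrow> \<bar>s\<bar> \<le> 1 \<Longrightarrow> \<bar>diff_quot \<eta> v s x\<bar> \<le> C'"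
    using diff_quot_bounded[OF \<eta>, where R=R' and v=v] by blast
  obtain M where M: "\<And>x. \<bar>\<eta> x\<bar> \<le> M"
    using continuous_compact_support_bounded[OF c\<eta> \<eta>0] by metis
  obtain Mf where Mf: "\<And>x. norm x \<le> R' \<Longrightarrow> \<bar>f x\<bar> \<le> Mf"
  proof -
    have "bounded (f ` cball 0 R')"
      by (intro compact_imp_bounded compact_continuous_image continuous_on_subset[OF cf]) auto
    then obtain a where "\<forall>y\<in>f ` cball 0 R'. norm y \<le> a" unfolding bounded_iff by blast
    then show thesis using that[of a] by auto
  qed
  have limA: "(\<lambda>n. \<integral>x. A n x \<partial>lborel) \<longlonglongrightarrow> (\<integral>x. dirder f v x * \<eta> x \<partial>lborel)"
  proof (rule dominated_convergence_compact_support(1)[where R=R and C="C * M"])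
    show "AE x in lborel. (\<lambda>n. A n x) \<longlonglongrightarrow> dirder f v x * \<eta> x"
      using AE_has_dirder[OF f, of v]
    proof eventually_elim
      case (elim x)
      have "(\<lambda>n. diff_quot f v (s n) x) \<longlonglongrightarrow> dirder f v x"
        using has_dirder_seq(1)[OF elim] by (simp add: s_def)
      then show ?case unfolding A_def by (rule tendsto_mult_right)
    qed
    fix n and x :: 'a assume x: "norm x \<le> R"
    show "\<bar>A n x\<bar> \<le> C * M"
      unfolding A_def abs_mult using M C x s by (intro mult_mono) auto
  next
    show "(\<lambda>x. dirder f v x * \<eta> x) \<in> borel_measurable lborel"
      using dirder_measurable[OF f] \<eta>m by simp
    show "A n \<in> borel_measurable lborel" for n
      using borel_measurable_continuous_onI[OF cA] by simp
  qed (auto simp: A_def \<eta>0)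
  have limB: "(\<lambda>n. \<integral>x. B n x \<partial>lborel) \<longlonglongrightarrow> (\<integral>x. f x * dirder \<eta> v x \<partial>lborel)"
  proof (rule dominated_convergence_compact_support(1)[where R=R' and C="Mf * C'"])
    show "AE x in lborel. (\<lambda>n. B n x) \<longlonglongrightarrow> f x * dirder \<eta> v x"
      using AE_has_dirder[OF \<eta>, of v]
    proof eventually_elim
      case (elim x)
      have "(\<lambda>n. diff_quot \<eta> v (- s n) x) \<longlonglongrightarrow> dirder \<eta> v x"
        using has_dirder_seq(2)[OF elim] by (simp add: s_def)
      then show ?case unfolding B_def by (rule tendsto_mult_left)
    qed
    fix n and x :: 'a assume x: "norm x \<le> R'"
    have "0 \<le> Mf" using Mf[OF x] by linarith
    then show "\<bar>B n x\<bar> \<le> Mf * C'"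
      unfolding B_def abs_mult using Mf C'(2)[of x "- s n"] x s by (intro mult_mono) auto
  next
    show "(\<lambda>x. f x * dirder \<eta> v x) \<in> borel_measurable lborel"
      using dirder_measurable[OF \<eta>] fm by simp
    show "B n \<in> borel_measurable lborel" for n
      using borel_measurable_continuous_onI[OF cB] by simp
    show "B n x = 0" if "R' < norm x" for n x
      using shift[OF that, of n] that RR' by (simp add: B_def diff_quot_def \<eta>0)
  qed
  have "(\<lambda>n. \<integral>x. A n x \<partial>lborel) \<longlonglongrightarrow> - (\<integral>x. f x * dirder \<eta> v x \<partial>lborel)"
    unfolding AB using limB by (rule tendsto_minus)
  with limA show ?thesis by (rule LIMSEQ_unique)
qed

lemma smooth_differentiable:
  assumes "smooth g"
  shows "g differentiable (at x)"
  using assms[unfolded smooth_def, rule_format, of "Suc 0"] by simp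

lemma smooth_continuous_on:
  assumes "smooth g"
  shows "continuous_on UNIV g"
  using assms[unfolded smooth_def, rule_format, of 0] by simp

text \<open>All derivatives of smooth functions are expressed through \<open>dirder\<close>, which agrees with the
  Frechet derivative at every point.\<close>

lemma smooth_dirder:
  assumes g: "smooth g"
  shows "smooth (dirder g v)"
proof -
  have "dirder g v = (\<lambda>x. frechet_derivative g (at x) v)"
    by (rule ext) (intro differentiable_imp_has_dirder smooth_differentiable g)
  moreover have "C_k k (\<lambda>x. frechet_derivative g (at x) v)" for k
    using g[unfolded smooth_def, rule_format, of "Suc k"] by simp
  ultimately show ?thesis by (simp add: smooth_def)
qed

lemma smooth_locally_lipschitz:
  fixes g :: "'a::euclidean_space \<Rightarrow> real"
  assumes g: "smooth g"
  shows "locally_lipschitz g"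
  unfolding locally_lipschitz_def
proof
  fix x :: 'a
  define B where "B y = (\<Sum>b\<in>Basis. \<bar>dirder g b y\<bar>)" for y
  have "continuous_on UNIV B"
    unfolding B_def by (intro continuous_intros smooth_continuous_on smooth_dirder g)
  then have "compact (B ` cball x 1)"
    by (intro compact_continuous_image) (auto intro: continuous_on_subset)
  then obtain C where C: "\<And>y. y \<in> cball x 1 \<Longrightarrow> B y \<le> C"
    by (meson bounded_imp_bdd_above bdd_above.unfold compact_imp_bounded imageI)
  have "C-lipschitz_on (cball x 1) g"
  proof (rule bounded_derivative_imp_lipschitz)
    fix y assume y: "y \<in> cball x 1"
    have D: "(g has_derivative (\<lambda>h. h \<bullet> grad g y)) (at y)"
      by (intro has_derivative_grad smooth_differentiable g)
    then show "(g has_derivative (\<lambda>h. h \<bullet> grad g y)) (at y within cball x 1)"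
      by (rule has_derivative_at_withinI)
    show "onorm (\<lambda>h. h \<bullet> grad g y) \<le> C"
    proof (rule onorm_bound)
      have "norm (grad g y) \<le> B y"
      proof -
        have "norm (grad g y) \<le> (\<Sum>b\<in>Basis. \<bar>grad g y \<bullet> b\<bar>)" by (rule norm_le_l1)
        also have "\<dots> = B y"
          unfolding B_def
          by (intro sum.cong refl arg_cong[where f=abs])
            (simp add: differentiable_imp_has_dirder(2) smooth_differentiable g inner_commute)
        finally show ?thesis .
      qed
      also have "\<dots> \<le> C" by (rule C[OF y])
      finally have n: "norm (grad g y) \<le> C" .
      then show "0 \<le> C" using norm_ge_zero order_trans by blast
      fix h
      have "norm (h \<bullet> grad g y) \<le> norm h * norm (grad g y)"
        using Cauchy_Schwarz_ineq2 by simp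
      also have "\<dots> \<le> norm h * C" using n by (intro mult_left_mono) auto
      finally show "norm (h \<bullet> grad g y) \<le> C * norm h" by (simp add: mult.commute)
    qed
  next
    have "0 \<le> B x" by (simp add: B_def sum_nonneg)
    then show "0 \<le> C" using C[of x] by simp
  qed simp
  then show "\<exists>u>0. \<exists>L. L-lipschitz_on (cball x u) g" by (intro exI[of _ 1]) auto
qed

lemma test_function_smooth: "test_function g \<Longrightarrow> smooth g"
  by (simp add: test_function_def)

lemma test_function_support:
  fixes g :: "'a::euclidean_space \<Rightarrow> real"
  assumes "test_function g"
  obtains R where "0 \<le> R" "\<And>x. R < norm x \<Longrightarrow> g x = 0"
proof -
  have "bounded (closure {x. g x \<noteq> 0})"
    using assms unfolding test_function_def by (blast intro: compact_imp_bounded)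
  then obtain R where R: "\<forall>x\<in>closure {x. g x \<noteq> 0}. norm x \<le> R"
    unfolding bounded_iff by blast
  show thesis
  proof (rule that[of "max 0 R"])
    show "g x = 0" if "max 0 R < norm x" for x
    proof (rule ccontr)
      assume "g x \<noteq> 0"
      then have "x \<in> closure {x. g x \<noteq> 0}" by (intro subsetD[OF closure_subset]) simp
      then have "norm x \<le> R" by (rule bspec[OF R])
      then show False using that by simp
    qed
  qed simp
qed

lemma test_function_dirder:
  fixes g :: "'a::euclidean_space \<Rightarrow> real"
  assumes g: "test_function g"
  shows "test_function (dirder g v)"
  unfolding test_function_def
proof
  show "smooth (dirder g v)" using g by (simp add: test_function_def smooth_dirder)
  define K where "K = closure {x. g x \<noteq> 0}"
  have "dirder g v x = 0" if "x \<notin> K" for x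
  proof -
    have "((\<lambda>s. x + s *\<^sub>R v) \<longlongrightarrow> x + 0 *\<^sub>R v) (at 0)" by (intro tendsto_intros)
    then have "((\<lambda>s. x + s *\<^sub>R v) \<longlongrightarrow> x) (at 0)" by simp
    from topological_tendstoD[OF this, of "- K"]
    have "\<forall>\<^sub>F s in at 0. x + s *\<^sub>R v \<in> - K" using that by (simp add: K_def open_Compl)
    then have "\<forall>\<^sub>F s in at 0. 0 = diff_quot g v s x"
    proof eventually_elim
      case (elim s)
      have "g y = 0" if "y \<notin> K" for y using that closure_subset[of "{x. g x \<noteq> 0}"] by (auto simp: K_def)
      then show ?case using elim \<open>x \<notin> K\<close> by (simp add: diff_quot_def)
    qed
    then have "((\<lambda>s. diff_quot g v s x) \<longlongrightarrow> 0) (at 0)"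
      using tendsto_const by (rule Lim_transform_eventually[rotated])
    then show ?thesis by (rule dirder_eqI)
  qed
  then have "closure {x. dirder g v x \<noteq> 0} \<subseteq> K"
    by (intro closure_minimal) (auto simp: K_def)
  moreover have "compact K" using g by (simp add: test_function_def K_def)
  ultimately show "compact (closure {x. dirder g v x \<noteq> 0})"
    using compact_Int_closed[of K "closure {x. dirder g v x \<noteq> 0}"] by (simp add: Int_absorb1)
qed

lemma dirder_compose_affine:
  assumes p: "\<And>s. p (x + s *\<^sub>R v) = p x + s *\<^sub>R (k *\<^sub>R w)" and "has_dirder g w (p x)"
  shows "dirder (\<lambda>x. g (p x)) v x = k * dirder g w (p x)"
proof -
  have "diff_quot (\<lambda>x. g (p x)) v s x = diff_quot g (k *\<^sub>R w) s (p x)" for s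
    by (simp add: diff_quot_def p)
  then have "dirder (\<lambda>x. g (p x)) v x = dirder g (k *\<^sub>R w) (p x)"
    by (simp add: dirder_def)
  then show ?thesis using dirder_scale[OF assms(2)] by simp
qed

lemma dirder_cmult:
  assumes "has_dirder g v x"
  shows "dirder (\<lambda>x. c * g x) v x = c * dirder g v x"
proof (rule dirder_eqI)
  have "diff_quot (\<lambda>x. c * g x) v s x = c * diff_quot g v s x" for s
    by (simp add: diff_quot_def right_diff_distrib)
  then show "((\<lambda>s. diff_quot (\<lambda>x. c * g x) v s x) \<longlongrightarrow> c * dirder g v x) (at 0)"
    using assms unfolding has_dirder_def by (simp add: tendsto_mult_left)
qed

lemma integral_lebesgue_AE_eq:
  fixes G H :: "'a::euclidean_space \<Rightarrow> real"
  assumes H: "H \<in> borel_measurable borel" and eq: "AE x in lborel. G x = H x"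
  shows "(\<integral>x. G x \<partial>lebesgue) = (\<integral>x. H x \<partial>lborel)"
proof -
  have Hl: "H \<in> borel_measurable lebesgue" using H by (intro measurable_completion) simp
  have "AE x in lebesgue. H x = G x" using AE_completion[OF eq] by eventually_elim simp
  then have Gl: "G \<in> borel_measurable lebesgue" by (rule borel_measurable_AE[OF Hl])
  have "(\<integral>x. G x \<partial>lebesgue) = (\<integral>x. H x \<partial>lebesgue)"
    using Gl Hl AE_completion[OF eq] by (rule integral_cong_AE)
  also have "\<dots> = (\<integral>x. H x \<partial>lborel)"
    using H by (intro integral_completion) simp
  finally show ?thesis .
qed

text \<open>The distribution \<open>u\<^sup>T (D\<^sup>2 f) v\<close> is the second distributional derivative of \<open>f\<close>, with no
  derivative left on \<open>f\<close>. By Rademacher's theorem the dummy value of \<open>grad f\<close> plays no role.\<close>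

lemma D2_eq_integral_dirder:
  fixes f g :: "'a::euclidean_space \<Rightarrow> real"
  assumes f: "locally_lipschitz f" and g: "\<And>x. g differentiable (at x)"
    and \<eta>: "locally_lipschitz (dirder g v)" "\<And>x. R < norm x \<Longrightarrow> dirder g v x = 0"
  shows "D2 f u v g = (\<integral>x. f x * dirder (dirder g v) u x \<partial>lborel)"
proof -
  have "(\<integral>x. (u \<bullet> grad f x) * (v \<bullet> grad g x) \<partial>lebesgue) = (\<integral>x. dirder f u x * dirder g v x \<partial>lborel)"
  proof (rule integral_lebesgue_AE_eq)
    have "dirder g v \<in> borel_measurable borel"
      using locally_lipschitz_continuous_on[OF \<eta>(1)] by (rule borel_measurable_continuous_onI)
    then show "(\<lambda>x. dirder f u x * dirder g v x) \<in> borel_measurable borel"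
      using dirder_measurable[OF f] by simp
    show "AE x in lborel. (u \<bullet> grad f x) * (v \<bullet> grad g x) = dirder f u x * dirder g v x"
      using rademacher[OF f]
      by eventually_elim (simp add: differentiable_imp_has_dirder(2) g)
  qed
  also have "\<dots> = - (\<integral>x. f x * dirder (dirder g v) u x \<partial>lborel)"
    by (rule dirder_integration_by_parts[OF f \<eta>])
  finally show ?thesis by (simp add: D2_def)
qed

lemma
  fixes K :: "'a::euclidean_space \<Rightarrow> 'b::euclidean_space \<Rightarrow> real"
  assumes K: "continuous_on UNIV (\<lambda>p. K (fst p) (snd p))"
    and supp: "\<And>t x. R < norm (t, x) \<Longrightarrow> K t x = 0"
  shows Fubini_continuous_compact_support:
      "(\<integral>t. (\<integral>x. K t x \<partial>lborel) \<partial>lborel) = (\<integral>x. (\<integral>t. K t x \<partial>lborel) \<partial>lborel)"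
    and integral_continuous_compact_support_prod:
      "(\<integral>t. (\<integral>x. K t x \<partial>lborel) \<partial>lborel) = (\<integral>p. K (fst p) (snd p) \<partial>lborel)"
    and integrable_continuous_compact_support_fst:
      "integrable lborel (\<lambda>t. \<integral>x. K t x \<partial>lborel)"
proof -
  have "integrable lborel (\<lambda>p. K (fst p) (snd p))"
    using supp by (intro continuous_compact_support_integrable[OF K, where R=R]) simp
  then have i: "integrable (lborel \<Otimes>\<^sub>M lborel) (\<lambda>(t, x). K t x)"
    by (simp add: lborel_prod case_prod_unfold)
  show "(\<integral>t. (\<integral>x. K t x \<partial>lborel) \<partial>lborel) = (\<integral>x. (\<integral>t. K t x \<partial>lborel) \<partial>lborel)"
    using lborel_pair.Fubini_integral[OF i] by simp
  show "(\<integral>t. (\<integral>x. K t x \<partial>lborel) \<partial>lborel) = (\<integral>p. K (fst p) (snd p) \<partial>lborel)"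
    using lborel_pair.integral_fst'[OF i] by (simp add: lborel_prod case_prod_unfold)
  show "integrable lborel (\<lambda>t. \<integral>x. K t x \<partial>lborel)"
    using lborel_pair.integrable_fst'[OF i] by simp
qed

section \<open>The convolution along a line\<close>

lemma locally_lipschitz_cmult:
  fixes f :: "'a::metric_space \<Rightarrow> real"
  assumes "locally_lipschitz f"
  shows "locally_lipschitz (\<lambda>x. c * f x)"
  unfolding locally_lipschitz_def
proof
  fix x
  obtain u L where u: "u > 0" "L-lipschitz_on (cball x u) f"
    using assms unfolding locally_lipschitz_def by blast
  have "(\<bar>c\<bar> * L)-lipschitz_on (cball x u) (\<lambda>x. c *\<^sub>R f x)"
    by (rule lipschitz_on_cmult[OF u(2)])
  then show "\<exists>u>0. \<exists>L. L-lipschitz_on (cball x u) (\<lambda>x. c * f x)"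
    using u(1) by auto
qed

lemma lipschitz_on_affine_point:
  fixes y :: "'a::real_normed_vector"
  assumes "\<gamma> > 0"
  shows "(1 / \<gamma>)-lipschitz_on UNIV (\<lambda>x. (1 / \<gamma>) *\<^sub>R (y - x))"
proof (rule lipschitz_onI)
  fix x x' :: 'a
  have "(1 / \<gamma>) *\<^sub>R (y - x) - (1 / \<gamma>) *\<^sub>R (y - x') = (1 / \<gamma>) *\<^sub>R (x' - x)"
    by (simp add: scaleR_diff_right)
  then show "dist ((1 / \<gamma>) *\<^sub>R (y - x)) ((1 / \<gamma>) *\<^sub>R (y - x')) \<le> 1 / \<gamma> * dist x x'"
    using assms by (simp add: dist_norm norm_minus_commute)
qed (use assms in simp)

lemma lipschitz_on_affine_line:
  fixes z :: "'a::real_normed_vector"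
  assumes "\<gamma> > 0"
  shows "(norm w / \<gamma>)-lipschitz_on UNIV (\<lambda>t. (1 / \<gamma>) *\<^sub>R (z + t *\<^sub>R w - x))"
proof (rule lipschitz_onI)
  fix t s :: real
  have "(1 / \<gamma>) *\<^sub>R (z + t *\<^sub>R w - x) - (1 / \<gamma>) *\<^sub>R (z + s *\<^sub>R w - x) = (1 / \<gamma>) *\<^sub>R ((t - s) *\<^sub>R w)"
    by (simp add: algebra_simps)
  then show "dist ((1 / \<gamma>) *\<^sub>R (z + t *\<^sub>R w - x)) ((1 / \<gamma>) *\<^sub>R (z + s *\<^sub>R w - x)) \<le> norm w / \<gamma> * dist t s"
    using assms by (simp add: dist_norm mult.commute)
qed (use assms in simp)

lemma test_function_has_dirder:
  assumes "test_function g"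
  shows "has_dirder g v x"
  by (intro differentiable_imp_has_dirder smooth_differentiable test_function_smooth assms)

lemma test_function_locally_lipschitz:
  assumes "test_function g"
  shows "locally_lipschitz g"
  by (intro smooth_locally_lipschitz test_function_smooth assms)

lemma test_function_continuous_on:
  assumes "test_function g"
  shows "continuous_on UNIV g"
  by (intro smooth_continuous_on test_function_smooth assms)

lemma convolution_D2:
  fixes f \<phi> :: "'a::euclidean_space \<Rightarrow> real"
  assumes f: "locally_lipschitz f" and \<phi>: "test_function \<phi>" and \<gamma>: "\<gamma> > 0"
  shows "convolution (rescale \<gamma> \<phi>) (D2 f w w) y =
    (\<integral>x. f x * ((1 / \<gamma> ^ (DIM('a) + 2)) * dirder (dirder \<phi> w) w ((1 / \<gamma>) *\<^sub>R (y - x))) \<partial>lborel)"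
proof -
  define p where "p x = (1 / \<gamma>) *\<^sub>R (y - x)" for x
  define c where "c = 1 / \<gamma> ^ DIM('a)"
  define \<phi>1 where "\<phi>1 = dirder \<phi> w"
  have \<phi>1: "test_function \<phi>1" unfolding \<phi>1_def by (rule test_function_dirder[OF \<phi>])
  have p: "p (x + s *\<^sub>R w) = p x + s *\<^sub>R ((- 1 / \<gamma>) *\<^sub>R w)" for x s
    by (simp add: p_def algebra_simps)
  have pd: "p differentiable (at x)" for x unfolding p_def
    by (intro derivative_intros)
  have diff: "(\<lambda>x. g (p x)) differentiable (at x)" if "test_function g" for g :: "'a \<Rightarrow> real" and x
    using differentiable_chain_at[OF pd smooth_differentiable[OF test_function_smooth[OF that]]]
    by (simp add: o_def)
  have d: "dirder (\<lambda>x. k * g (p x)) w = (\<lambda>x. k * (- 1 / \<gamma>) * dirder g w (p x))"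
    if g: "test_function g" for g :: "'a \<Rightarrow> real" and k
  proof
    fix x
    have "dirder (\<lambda>x. k * g (p x)) w x = k * dirder (\<lambda>x. g (p x)) w x"
      by (intro dirder_cmult differentiable_imp_has_dirder diff g)
    also have "dirder (\<lambda>x. g (p x)) w x = (- 1 / \<gamma>) * dirder g w (p x)"
      by (rule dirder_compose_affine[OF p test_function_has_dirder[OF g]])
    finally show "dirder (\<lambda>x. k * g (p x)) w x = k * (- 1 / \<gamma>) * dirder g w (p x)" by simp
  qed
  obtain R where R: "0 \<le> R" "\<And>x. R < norm x \<Longrightarrow> \<phi>1 x = 0"
    using test_function_support[OF \<phi>1] by blast
  have "convolution (rescale \<gamma> \<phi>) (D2 f w w) y = D2 f w w (\<lambda>x. c * \<phi> (p x))"
    by (simp add: convolution_def rescale_def p_def c_def)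
  also have "\<dots> = (\<integral>x. f x * dirder (dirder (\<lambda>x. c * \<phi> (p x)) w) w x \<partial>lborel)"
  proof (rule D2_eq_integral_dirder[OF f])
    show "(\<lambda>x. c * \<phi> (p x)) differentiable at x" for x
      using diff[OF \<phi>] by (intro derivative_intros)
    show "locally_lipschitz (dirder (\<lambda>x. c * \<phi> (p x)) w)"
      unfolding d[OF \<phi>] unfolding p_def
      by (intro locally_lipschitz_cmult locally_lipschitz_compose[OF _ lipschitz_on_affine_point[OF \<gamma>]]
          test_function_locally_lipschitz test_function_dirder \<phi>)
    show "dirder (\<lambda>x. c * \<phi> (p x)) w x = 0" if x: "norm y + \<gamma> * R < norm x" for x
    proof -
      have "norm x - norm y \<le> norm (y - x)"
        by (metis norm_minus_commute norm_triangle_ineq2)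
      then have "\<gamma> * R < norm (y - x)" using x by linarith
      moreover have "norm (p x) = norm (y - x) / \<gamma>"
        unfolding p_def norm_scaleR using \<gamma> by simp
      ultimately have "R < norm (p x)" using \<gamma> by (simp add: pos_less_divide_eq mult.commute)
      then show ?thesis using R(2) by (simp add: d[OF \<phi>] \<phi>1_def)
    qed
  qed
  also have "dirder (dirder (\<lambda>x. c * \<phi> (p x)) w) w =
      (\<lambda>x. (1 / \<gamma> ^ (DIM('a) + 2)) * dirder (dirder \<phi> w) w (p x))"
    unfolding d[OF \<phi>] d[OF test_function_dirder[OF \<phi>]]
    by (simp add: c_def power2_eq_square power_add mult_ac)
  finally show ?thesis by (simp add: p_def)
qed

text \<open>Along the line, \<open>\<gamma>\<^bsup>-2\<^esup>\<close> times the second derivative of \<open>\<phi>\<close> at the rescaled point is the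
  second derivative with respect to \<open>t\<close>, and two integrations by parts move it to \<open>g\<close>. For
  \<open>w = 0\<close> the rescaled \<open>\<phi>\<close> need not have compact support in \<open>t\<close>, but only \<open>g\<close> needs one.\<close>

lemma integral_dirder_line:
  fixes \<phi> :: "'a::euclidean_space \<Rightarrow> real" and g :: "real \<Rightarrow> real"
  assumes \<phi>: "test_function \<phi>" and g: "test_function g" and \<gamma>: "\<gamma> > 0"
  shows "(\<integral>t. g t * dirder (dirder \<phi> w) w ((1 / \<gamma>) *\<^sub>R (z + t *\<^sub>R w - x)) \<partial>lborel) =
    \<gamma>\<^sup>2 * (\<integral>t. dirder (dirder g 1) 1 t * \<phi> ((1 / \<gamma>) *\<^sub>R (z + t *\<^sub>R w - x)) \<partial>lborel)"
proof -
  define p where "p t = (1 / \<gamma>) *\<^sub>R (z + t *\<^sub>R w - x)" for t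
  have p: "p (t + s *\<^sub>R 1) = p t + s *\<^sub>R ((1 / \<gamma>) *\<^sub>R w)" for t s
    by (simp add: p_def algebra_simps)
  have step: "(\<integral>t. \<eta> t * dirder \<psi> w (p t) \<partial>lborel) = - \<gamma> * (\<integral>t. dirder \<eta> 1 t * \<psi> (p t) \<partial>lborel)"
    if \<psi>: "test_function \<psi>" and \<eta>: "test_function \<eta>" for \<psi> :: "'a \<Rightarrow> real" and \<eta> :: "real \<Rightarrow> real"
  proof -
    obtain R where R: "\<And>t. R < norm t \<Longrightarrow> \<eta> t = 0" using test_function_support[OF \<eta>] by blast
    have ll: "locally_lipschitz (\<lambda>t. \<psi> (p t))"
      unfolding p_def
      by (rule locally_lipschitz_compose[OF test_function_locally_lipschitz[OF \<psi>] lipschitz_on_affine_line[OF \<gamma>]])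
    have "dirder (\<lambda>t. \<psi> (p t)) 1 t = (1 / \<gamma>) * dirder \<psi> w (p t)" for t
      by (rule dirder_compose_affine[OF p test_function_has_dirder[OF \<psi>]])
    then have "(\<integral>t. (1 / \<gamma>) * dirder \<psi> w (p t) * \<eta> t \<partial>lborel) = - (\<integral>t. \<psi> (p t) * dirder \<eta> 1 t \<partial>lborel)"
      using dirder_integration_by_parts[OF ll test_function_locally_lipschitz[OF \<eta>] R, where v=1] by simp
    then show ?thesis using \<gamma> by (simp add: mult.assoc field_simps)
  qed
  have "(\<integral>t. g t * dirder (dirder \<phi> w) w (p t) \<partial>lborel) =
      - \<gamma> * (- \<gamma> * (\<integral>t. dirder (dirder g 1) 1 t * \<phi> (p t) \<partial>lborel))"
    by (simp only: step test_function_dirder \<phi> g)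
  then show ?thesis by (simp add: p_def power2_eq_square)
qed

text \<open>The kernel vanishes unless \<open>t\<close> is in the support of \<open>r\<close> and \<open>x\<close> is at distance at most
  \<open>\<gamma> Rq\<close> from the point \<open>z + t w\<close>.\<close>

lemma
  fixes f q :: "'a::euclidean_space \<Rightarrow> real" and r :: "real \<Rightarrow> real" and z w :: 'a and c :: real
  assumes f: "continuous_on UNIV f" and r: "continuous_on UNIV r" and q: "continuous_on UNIV q"
    and r0: "\<And>t. Rr < norm t \<Longrightarrow> r t = 0" and q0: "\<And>x. Rq < norm x \<Longrightarrow> q x = 0" and \<gamma>: "\<gamma> > 0"
  defines "K \<equiv> \<lambda>t x. r t * (f x * (c * q ((1 / \<gamma>) *\<^sub>R (z + t *\<^sub>R w - x))))"
  shows continuous_on_line_kernel: "continuous_on UNIV (\<lambda>p. K (fst p) (snd p))"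
    and line_kernel_support: "\<And>t x. Rr + (norm z + Rr * norm w + \<gamma> * Rq) < norm (t, x) \<Longrightarrow> K t x = 0"
proof -
  show "continuous_on UNIV (\<lambda>p. K (fst p) (snd p))"
    unfolding K_def
    by (intro continuous_intros continuous_on_compose2[OF f] continuous_on_compose2[OF r]
        continuous_on_compose2[OF q]) auto
  fix t :: real and x :: 'a
  assume big: "Rr + (norm z + Rr * norm w + \<gamma> * Rq) < norm (t, x)"
  show "K t x = 0"
  proof (rule ccontr)
    assume "K t x \<noteq> 0"
    then have "r t \<noteq> 0" "q ((1 / \<gamma>) *\<^sub>R (z + t *\<^sub>R w - x)) \<noteq> 0" by (auto simp: K_def)
    then have t: "\<bar>t\<bar> \<le> Rr" and "norm ((1 / \<gamma>) *\<^sub>R (z + t *\<^sub>R w - x)) \<le> Rq"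
      using r0[of t] q0[of "(1 / \<gamma>) *\<^sub>R (z + t *\<^sub>R w - x)"] by (force simp del: norm_scaleR)+
    then have 1: "norm (z + t *\<^sub>R w - x) \<le> \<gamma> * Rq"
      unfolding norm_scaleR using \<gamma> by (simp add: pos_divide_le_eq mult.commute)
    have "norm x \<le> norm (z + t *\<^sub>R w) + norm (z + t *\<^sub>R w - x)"
      by (metis norm_minus_commute norm_triangle_sub)
    also have "norm (z + t *\<^sub>R w) \<le> norm z + \<bar>t\<bar> * norm w"
      by (metis norm_scaleR norm_triangle_ineq)
    also have "\<bar>t\<bar> * norm w \<le> Rr * norm w" using t by (intro mult_right_mono) auto
    finally have "norm x \<le> norm z + Rr * norm w + \<gamma> * Rq" using 1 by simp
    moreover have "norm (t, x) \<le> \<bar>t\<bar> + norm x"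
      using norm_Pair_le[of t x] by simp
    ultimately show False using big t by linarith
  qed
qed

text \<open>Exchange the integrals over the line and over the space, integrate by parts on the line,
  exchange them again and substitute \<open>x = z + t w - \<gamma> u\<close>.\<close>

lemma convolution_D2_line_pairing:
  fixes f \<phi> :: "'a::euclidean_space \<Rightarrow> real" and z w :: 'a
  assumes f: "locally_lipschitz f" and \<phi>: "test_function \<phi>" and g: "test_function g" and \<gamma>: "\<gamma> > 0"
  defines "F \<equiv> \<lambda>t. convolution (rescale \<gamma> \<phi>) (D2 f w w) (z + t *\<^sub>R w)"
  shows "integrable lborel (\<lambda>t. g t * F t)"
    and "(\<integral>t. g t * F t \<partial>lborel) =
      (\<integral>t. dirder (dirder g 1) 1 t * (\<integral>u. f (z + t *\<^sub>R w - \<gamma> *\<^sub>R u) * \<phi> u \<partial>lborel) \<partial>lborel)"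
proof -
  define g2 where "g2 = dirder (dirder g 1) 1"
  define \<phi>2 where "\<phi>2 = dirder (dirder \<phi> w) w"
  define n where "n = DIM('a)"
  define p where "p t x = (1 / \<gamma>) *\<^sub>R (z + t *\<^sub>R w - x)" for t x
  have g2: "test_function g2" and \<phi>2: "test_function \<phi>2"
    unfolding g2_def \<phi>2_def by (intro test_function_dirder g \<phi>)+
  have cf: "continuous_on UNIV f" by (rule locally_lipschitz_continuous_on[OF f])
  obtain Rg where Rg: "\<And>t. Rg < norm t \<Longrightarrow> g t = 0" using test_function_support[OF g] by blast
  obtain Rg2 where Rg2: "\<And>t. Rg2 < norm t \<Longrightarrow> g2 t = 0" using test_function_support[OF g2] by blast
  obtain R where R: "\<And>x. R < norm x \<Longrightarrow> \<phi> x = 0" using test_function_support[OF \<phi>] by blast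
  obtain R2 where R2: "\<And>x. R2 < norm x \<Longrightarrow> \<phi>2 x = 0" using test_function_support[OF \<phi>2] by blast
  \<comment> \<open>\<open>K1\<close> and \<open>K2\<close> are the integrands before and after the two derivatives move from
    \<open>\<phi>\<close> to \<open>g\<close>.\<close>
  define K1 where "K1 t x = g t * (f x * ((1 / \<gamma> ^ (n + 2)) * \<phi>2 (p t x)))" for t x
  define K2 where "K2 t x = g2 t * (f x * ((1 / \<gamma> ^ n) * \<phi> (p t x)))" for t x
  note c = test_function_continuous_on
  have K1c: "continuous_on UNIV (\<lambda>p. K1 (fst p) (snd p))"
    and K10: "\<And>t x. Rg + (norm z + Rg * norm w + \<gamma> * R2) < norm (t, x) \<Longrightarrow> K1 t x = 0"
    unfolding K1_def p_def
    by (rule continuous_on_line_kernel[OF cf c[OF g] c[OF \<phi>2] Rg R2 \<gamma>];assumption?)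
      (rule line_kernel_support[OF cf c[OF g] c[OF \<phi>2] Rg R2 \<gamma>];assumption?)
  have K2c: "continuous_on UNIV (\<lambda>p. K2 (fst p) (snd p))"
    and K20: "\<And>t x. Rg2 + (norm z + Rg2 * norm w + \<gamma> * R) < norm (t, x) \<Longrightarrow> K2 t x = 0"
    unfolding K2_def p_def
    by (rule continuous_on_line_kernel[OF cf c[OF g2] c[OF \<phi>] Rg2 R \<gamma>];assumption?)
      (rule line_kernel_support[OF cf c[OF g2] c[OF \<phi>] Rg2 R \<gamma>];assumption?)
  have gF: "g t * F t = (\<integral>x. K1 t x \<partial>lborel)" for t
    unfolding F_def convolution_D2[OF f \<phi> \<gamma>] K1_def \<phi>2_def n_def p_def by simp
  show "integrable lborel (\<lambda>t. g t * F t)"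
    unfolding gF by (rule integrable_continuous_compact_support_fst[OF K1c K10])
  have "(\<integral>t. g t * F t \<partial>lborel) = (\<integral>x. (\<integral>t. K1 t x \<partial>lborel) \<partial>lborel)"
    unfolding gF by (rule Fubini_continuous_compact_support[OF K1c K10])
  also have "\<dots> = (\<integral>x. (\<integral>t. K2 t x \<partial>lborel) \<partial>lborel)"
  proof (rule Bochner_Integration.integral_cong[OF refl])
    fix x
    have "(\<integral>t. K1 t x \<partial>lborel) = (\<integral>t. (f x * (1 / \<gamma> ^ (n + 2))) * (g t * \<phi>2 (p t x)) \<partial>lborel)"
      by (simp add: K1_def mult_ac)
    also have "\<dots> = (f x * (1 / \<gamma> ^ (n + 2))) * (\<gamma>\<^sup>2 * (\<integral>t. g2 t * \<phi> (p t x) \<partial>lborel))"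
      unfolding p_def \<phi>2_def g2_def by (simp add: integral_dirder_line[OF \<phi> g \<gamma>])
    also have "\<dots> = (f x * (1 / \<gamma> ^ n)) * (\<integral>t. g2 t * \<phi> (p t x) \<partial>lborel)"
      using \<gamma> by (simp add: power_add power2_eq_square)
    also have "\<dots> = (\<integral>t. (f x * (1 / \<gamma> ^ n)) * (g2 t * \<phi> (p t x)) \<partial>lborel)"
      by simp
    also have "\<dots> = (\<integral>t. K2 t x \<partial>lborel)"
      by (simp add: K2_def mult_ac)
    finally show "(\<integral>t. K1 t x \<partial>lborel) = (\<integral>t. K2 t x \<partial>lborel)" .
  qed
  also have "\<dots> = (\<integral>t. (\<integral>x. K2 t x \<partial>lborel) \<partial>lborel)"
    by (rule Fubini_continuous_compact_support[OF K2c K20, symmetric])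
  also have "\<dots> = (\<integral>t. g2 t * (\<integral>u. f (z + t *\<^sub>R w - \<gamma> *\<^sub>R u) * \<phi> u \<partial>lborel) \<partial>lborel)"
  proof (rule Bochner_Integration.integral_cong[OF refl])
    fix t
    define H where "H x = f x * ((1 / \<gamma> ^ n) * \<phi> (p t x))" for x
    have "continuous_on UNIV H"
      unfolding H_def p_def
      by (intro continuous_intros cf continuous_on_compose2[OF c[OF \<phi>]]) auto
    then have Hm: "H \<in> borel_measurable borel" by (rule borel_measurable_continuous_onI)
    have "(\<integral>x. K2 t x \<partial>lborel) = g2 t * (\<integral>x. H x \<partial>lborel)"
      by (simp add: K2_def H_def)
    also have "(\<integral>x. H x \<partial>lborel) = (\<integral>u. \<gamma> ^ n * H (z + t *\<^sub>R w + (- \<gamma>) *\<^sub>R u) \<partial>lborel)"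
      using integral_lborel_affine[OF Hm, of "- \<gamma>" "z + t *\<^sub>R w"] \<gamma> by (simp add: n_def)
    also have "\<dots> = (\<integral>u. f (z + t *\<^sub>R w - \<gamma> *\<^sub>R u) * \<phi> u \<partial>lborel)"
      using \<gamma> by (intro Bochner_Integration.integral_cong[OF refl]) (simp add: H_def p_def)
    finally show "(\<integral>x. K2 t x \<partial>lborel) = g2 t * (\<integral>u. f (z + t *\<^sub>R w - \<gamma> *\<^sub>R u) * \<phi> u \<partial>lborel)" .
  qed
  finally show "(\<integral>t. g t * F t \<partial>lborel) =
      (\<integral>t. dirder (dirder g 1) 1 t * (\<integral>u. f (z + t *\<^sub>R w - \<gamma> *\<^sub>R u) * \<phi> u \<partial>lborel) \<partial>lborel)"
    by (simp add: g2_def)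
qed

text \<open>Dominated convergence on the product of the line and the space. The function \<open>\<phi>\<close> may change
  sign; only its integral and its compact support matter.\<close>

lemma mollified_line_limit:
  fixes f \<phi> :: "'a::euclidean_space \<Rightarrow> real" and r :: "real \<Rightarrow> real"
  assumes f: "continuous_on UNIV f"
    and r: "continuous_on UNIV r" "\<And>t. Rr < norm t \<Longrightarrow> r t = 0"
    and \<phi>: "continuous_on UNIV \<phi>" "\<And>x. R < norm x \<Longrightarrow> \<phi> x = 0"
    and int\<phi>: "(\<integral>u. \<phi> u \<partial>lborel) = 1"
  shows "((\<lambda>\<gamma>. \<integral>t. r t * (\<integral>u. f (z + t *\<^sub>R w - \<gamma> *\<^sub>R u) * \<phi> u \<partial>lborel) \<partial>lborel)
    \<longlongrightarrow> (\<integral>t. r t * f (z + t *\<^sub>R w) \<partial>lborel)) (at_right 0)"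
proof (rule tendsto_at_right_sequentially[of 0 1])
  fix S :: "nat \<Rightarrow> real"
  assume S: "\<And>n. 0 < S n" "\<And>n. S n < 1" "S \<longlonglongrightarrow> 0"
  \<comment> \<open>Since \<open>S n < 1\<close>, all points at which \<open>f\<close> is evaluated lie in one ball.\<close>
  define K where "K \<gamma> t u = r t * (f (z + t *\<^sub>R w - \<gamma> *\<^sub>R u) * \<phi> u)" for \<gamma> t u
  define R' where "R' = Rr + R"
  have K0: "K \<gamma> t u = 0" if "R' < norm (t, u)" for \<gamma> t u
  proof -
    have "Rr < norm t \<or> R < norm u"
      using that norm_Pair_le[of t u] unfolding R'_def by linarith
    then show ?thesis using r(2)[of t] \<phi>(2)[of u] by (auto simp: K_def)
  qed
  have Kc: "continuous_on UNIV (\<lambda>p. K \<gamma> (fst p) (snd p))" for \<gamma>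
    unfolding K_def
    by (intro continuous_intros continuous_on_compose2[OF f] continuous_on_compose2[OF r(1)]
        continuous_on_compose2[OF \<phi>(1)]) auto
  have prod: "(\<integral>t. r t * (\<integral>u. f (z + t *\<^sub>R w - \<gamma> *\<^sub>R u) * \<phi> u \<partial>lborel) \<partial>lborel) =
      (\<integral>p. K \<gamma> (fst p) (snd p) \<partial>lborel)" for \<gamma>
    using integral_continuous_compact_support_prod[OF Kc[of \<gamma>] K0] by (simp add: K_def)
  have at0: "(\<integral>t. r t * f (z + t *\<^sub>R w) \<partial>lborel) = (\<integral>p. K 0 (fst p) (snd p) \<partial>lborel)"
    unfolding prod[symmetric] by (simp add: int\<phi>)
  obtain Mr where Mr: "\<And>t. \<bar>r t\<bar> \<le> Mr"
    using continuous_compact_support_bounded[OF r] by blast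
  obtain M\<phi> where M\<phi>: "\<And>x. \<bar>\<phi> x\<bar> \<le> M\<phi>"
    using continuous_compact_support_bounded[OF \<phi>] by blast
  obtain Mf where Mf: "\<And>x. norm x \<le> norm z + R' * norm w + R' \<Longrightarrow> \<bar>f x\<bar> \<le> Mf"
  proof -
    have "bounded (f ` cball 0 (norm z + R' * norm w + R'))"
      by (intro compact_imp_bounded compact_continuous_image continuous_on_subset[OF f]) auto
    then obtain a where "\<forall>y\<in>f ` cball 0 (norm z + R' * norm w + R'). norm y \<le> a"
      unfolding bounded_iff by blast
    then show thesis using that[of a] by auto
  qed
  have "(\<lambda>n. \<integral>p. K (S n) (fst p) (snd p) \<partial>lborel) \<longlonglongrightarrow> (\<integral>p. K 0 (fst p) (snd p) \<partial>lborel)"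
  proof (rule dominated_convergence_compact_support(1)[where R=R' and C="Mr * (Mf * M\<phi>)"])
    show "(\<lambda>p. K \<gamma> (fst p) (snd p)) \<in> borel_measurable lborel" for \<gamma>
      using borel_measurable_continuous_onI[OF Kc] by simp
    show "AE p in lborel. (\<lambda>n. K (S n) (fst p) (snd p)) \<longlonglongrightarrow> K 0 (fst p) (snd p)"
    proof (rule AE_I2)
      fix p :: "real \<times> 'a"
      have "(\<lambda>n. z + fst p *\<^sub>R w - S n *\<^sub>R snd p) \<longlonglongrightarrow> z + fst p *\<^sub>R w - 0 *\<^sub>R snd p"
        by (intro tendsto_intros S(3))
      moreover have "isCont f (z + fst p *\<^sub>R w - 0 *\<^sub>R snd p)"
        using f continuous_on_eq_continuous_at open_UNIV by blast
      ultimately have "(\<lambda>n. f (z + fst p *\<^sub>R w - S n *\<^sub>R snd p)) \<longlonglongrightarrow> f (z + fst p *\<^sub>R w - 0 *\<^sub>R snd p)"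
        by (rule isCont_tendsto_compose[rotated])
      then show "(\<lambda>n. K (S n) (fst p) (snd p)) \<longlonglongrightarrow> K 0 (fst p) (snd p)"
        unfolding K_def by (intro tendsto_mult_left tendsto_mult_right)
    qed
    fix n and p :: "real \<times> 'a" assume p: "norm p \<le> R'"
    obtain t u where tu: "p = (t, u)" by (cases p)
    have t: "\<bar>t\<bar> \<le> R'" and u: "norm u \<le> R'"
      using p norm_fst_le[of t u] norm_snd_le[of u t] unfolding tu by auto
    have "norm (z + t *\<^sub>R w - S n *\<^sub>R u) \<le> norm (z + t *\<^sub>R w) + norm (S n *\<^sub>R u)"
      by (rule norm_triangle_ineq4)
    also have "norm (z + t *\<^sub>R w) \<le> norm z + norm (t *\<^sub>R w)" by (rule norm_triangle_ineq)
    also have "norm (t *\<^sub>R w) \<le> R' * norm w" using t by (simp add: mult_right_mono)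
    also have "norm (S n *\<^sub>R u) \<le> R'"
    proof -
      have "S n * norm u \<le> 1 * norm u" using S(2)[of n] by (intro mult_right_mono) auto
      then show ?thesis using u S(1)[of n] by simp
    qed
    finally have "\<bar>f (z + t *\<^sub>R w - S n *\<^sub>R u)\<bar> \<le> Mf" by (intro Mf) simp
    moreover from this have "0 \<le> Mf" by linarith
    ultimately have "\<bar>r t\<bar> * (\<bar>f (z + t *\<^sub>R w - S n *\<^sub>R u)\<bar> * \<bar>\<phi> u\<bar>) \<le> Mr * (Mf * M\<phi>)"
      using Mr[of t] M\<phi>[of u] by (intro mult_mono) auto
    then show "\<bar>K (S n) (fst p) (snd p)\<bar> \<le> Mr * (Mf * M\<phi>)"
      by (simp add: K_def tu abs_mult)
  next
    show "K (S n) (fst p) (snd p) = 0" if "R' < norm p" for n p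
      using that by (intro K0) simp
  qed (use borel_measurable_continuous_onI[OF Kc] in simp_all)
  then show "(\<lambda>n. \<integral>t. r t * (\<integral>u. f (z + t *\<^sub>R w - S n *\<^sub>R u) * \<phi> u \<partial>lborel) \<partial>lborel)
      \<longlonglongrightarrow> (\<integral>t. r t * f (z + t *\<^sub>R w) \<partial>lborel)"
    unfolding prod at0 .
qed simp

text \<open>There is no exceptional set of lines here: on every line the function is locally Lipschitz,
  hence continuous and differentiable almost everywhere.\<close>

lemma distributional_limit_line:
  fixes f \<phi> :: "'a::euclidean_space \<Rightarrow> real"
  assumes f: "locally_lipschitz f" and \<phi>: "mollifier \<phi>"
  shows "distributional_limit
      (\<lambda>\<gamma> t. convolution (rescale \<gamma> \<phi>) (D2 f w w) (z + t *\<^sub>R w))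
      (D2_real (\<lambda>t. f (z + t *\<^sub>R w)))"
  unfolding distributional_limit_def
proof (intro allI impI conjI)
  fix g :: "real \<Rightarrow> real" assume g: "test_function g"
  have \<phi>t: "test_function \<phi>" using \<phi> by (simp add: mollifier_def)
  define F where "F \<gamma> t = g t * convolution (rescale \<gamma> \<phi>) (D2 f w w) (z + t *\<^sub>R w)" for \<gamma> t
  define g2 where "g2 = dirder (dirder g 1) 1"
  have g2: "test_function g2" unfolding g2_def by (intro test_function_dirder g)
  have Fi: "integrable lborel (F \<gamma>)" if "\<gamma> > 0" for \<gamma>
    unfolding F_def by (rule convolution_D2_line_pairing(1)[OF f \<phi>t g that])
  have Fm: "F \<gamma> \<in> borel_measurable lborel" if "\<gamma> > 0" for \<gamma>
    using Fi[OF that] by (rule borel_measurable_integrable)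
  show "integrable lebesgue (\<lambda>t. g t * convolution (rescale \<gamma> \<phi>) (D2 f w w) (z + t *\<^sub>R w))"
    if "\<gamma> > 0" for \<gamma>
    using Fi[OF that] integrable_completion[OF Fm[OF that]] by (simp add: F_def[abs_def])
  obtain R1 where R1: "\<And>t. R1 < norm t \<Longrightarrow> dirder g 1 t = 0"
    using test_function_support[OF test_function_dirder[OF g, of 1]] by blast
  obtain R2 where R2: "\<And>t. R2 < norm t \<Longrightarrow> g2 t = 0" using test_function_support[OF g2] by blast
  obtain R where R: "\<And>x. R < norm x \<Longrightarrow> \<phi> x = 0" using test_function_support[OF \<phi>t] by blast
  have c\<phi>: "continuous_on UNIV \<phi>" by (rule test_function_continuous_on[OF \<phi>t])
  have int\<phi>: "(\<integral>u. \<phi> u \<partial>lborel) = 1"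
    using \<phi> integral_completion[of \<phi> lborel] borel_measurable_continuous_onI[OF c\<phi>]
    by (simp add: mollifier_def)
  have D: "D2_real (\<lambda>t. f (z + t *\<^sub>R w)) g = (\<integral>t. g2 t * f (z + t *\<^sub>R w) \<partial>lborel)"
    using D2_eq_integral_dirder[OF locally_lipschitz_line[OF f]
        smooth_differentiable[OF test_function_smooth[OF g]]
        test_function_locally_lipschitz[OF test_function_dirder[OF g]] R1, where u=1]
    by (simp add: g2_def mult.commute)
  have "((\<lambda>\<gamma>. \<integral>t. g2 t * (\<integral>u. f (z + t *\<^sub>R w - \<gamma> *\<^sub>R u) * \<phi> u \<partial>lborel) \<partial>lborel)
      \<longlongrightarrow> D2_real (\<lambda>t. f (z + t *\<^sub>R w)) g) (at_right 0)"
    unfolding D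
    by (rule mollified_line_limit[OF locally_lipschitz_continuous_on[OF f]
        test_function_continuous_on[OF g2] R2 c\<phi> R int\<phi>])
  moreover have "\<forall>\<^sub>F \<gamma> in at_right 0.
      (\<integral>t. g2 t * (\<integral>u. f (z + t *\<^sub>R w - \<gamma> *\<^sub>R u) * \<phi> u \<partial>lborel) \<partial>lborel) = (\<integral>t. F \<gamma> t \<partial>lebesgue)"
    using eventually_at_right_less[of 0]
  proof eventually_elim
    case (elim \<gamma>)
    have "(\<integral>t. F \<gamma> t \<partial>lebesgue) = (\<integral>t. F \<gamma> t \<partial>lborel)"
      by (rule integral_completion[OF Fm[OF elim]])
    then show ?case
      using convolution_D2_line_pairing(2)[OF f \<phi>t g elim, of w z] by (simp add: F_def g2_def)
  qed
  ultimately have "((\<lambda>\<gamma>. \<integral>t. F \<gamma> t \<partial>lebesgue) \<longlongrightarrow> D2_real (\<lambda>t. f (z + t *\<^sub>R w)) g) (at_right 0)"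
    by (rule Lim_transform_eventually)
  then show "((\<lambda>\<gamma>. \<integral>t. g t * convolution (rescale \<gamma> \<phi>) (D2 f w w) (z + t *\<^sub>R w) \<partial>lebesgue)
      \<longlongrightarrow> D2_real (\<lambda>t. f (z + t *\<^sub>R w)) g) (at_right 0)"
    by (simp add: F_def)
qed

lemma AE_differentiable_on_lines:
  fixes f :: "'a::euclidean_space \<Rightarrow> real"
  assumes f: "locally_lipschitz f"
  shows "AE z in lborel. AE t in lborel. f differentiable (at (z + t *\<^sub>R w))"
proof -
  obtain N where N: "{x. \<not> f differentiable (at x)} \<subseteq> N" "N \<in> null_sets lborel"
    using rademacher[OF f] by (auto elim!: AE_E2 simp: eventually_ae_filter)
  have "AE x in lborel. x \<notin> N" using N(2) by (rule AE_not_in)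
  then have "AE z in lborel. AE t in lborel. z + t *\<^sub>R w \<notin> N"
    using N(2) by (subst AE_lines_iff) (auto simp: pred_def null_sets_def)
  then show ?thesis
  proof eventually_elim
    case (elim z)
    then show ?case by eventually_elim (use N(1) in blast)
  qed
qed

theorem theorem7p4:
  fixes f \<phi> :: "real ^ 'n \<Rightarrow> real" and w :: "real ^ 'n"
  assumes "locally_lipschitz f"
    and "mollifier \<phi>"
  shows "AE z in lebesgue.
    (AE t in lebesgue. f differentiable (at (z + t *\<^sub>R w))) \<and>
    distributional_limit
      (\<lambda>\<gamma> t. convolution (rescale \<gamma> \<phi>) (D2 f w w) (z + t *\<^sub>R w))
      (D2_real (\<lambda>t. f (z + t *\<^sub>R w)))"
  using AE_completion[OF AE_differentiable_on_lines[OF assms(1), of w]]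
  by eventually_elim (intro conjI AE_completion distributional_limit_line assms)

end
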